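(* Let $R$ be a commutative Noetherian ring and let $M$ be a finitely generated, faithful, reflexive $R$-module. Identify $\operatorname{End}_R(\tau_M(R))$ with the subset $$\left\{ \tfrac{a}{b}\in Q(R) : \tfrac{a}{b}\,\tau_M(R)\subseteq\tau_M(R)\right\}$$ of the total ring of quotients $Q(R)$. Then $Z(\operatorname{End}_R(M)) = \operatorname{End}_R(\tau_M(R))$ as subsets of $Q(R)$, in the following sense: the map $\sigma$ (defined in the context) is a bijection from $\operatorname{End}_R(\tau_M(R))$ onto $Z(\operatorname{End}_R(M))$, and for every $a/b\in\operatorname{End}_R(\tau_M(R))$ the endomorphism $\sigma(a/b)$ is multiplication by $a/b$; that is, $aM\subseteq bM$ and, for each $m\in M$, $\sigma(a/b)(m) = (am)/b\in M$, where $(am)/b$ denotes the unique $n\in M$ with $bn=am$.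
   Context: For an $R$-module $M$ put $M^* = \operatorname{Hom}_R(M,R)$. The trace ideal of $M$ is $\tau_M(R) = \sum_{\alpha\in M^*}\alpha(M)\subseteq R$; it is the image of the trace map $\vartheta_M : M\otimes_R M^*\to R$, $m\otimes\alpha\mapsto\alpha(m)$. $M$ is reflexive if the evaluation map $M\to M^{**}$, $m\mapsto(\psi\mapsto\psi(m))$, is an isomorphism. $Z(S)$ is the center of a ring $S$ and $Q(R)$ is the total ring of quotients of $R$. If $M$ is finitely generated, reflexive and faithful over Noetherian $R$, then $\tau_M(R)$ contains a nonzerodivisor $x$, and the identification of $\operatorname{End}_R(\tau_M(R))$ with the displayed subset of $Q(R)$ is $h\mapsto h(x)/x$ (independent of the choice of $x$). Definition of $\sigma$ (for $M$ reflexive). Every $R$-homomorphism $\tau_M(R)\to R$ has image in $\tau_M(R)$, so $\operatorname{End}_R(\tau_M(R)) = \operatorname{Hom}_R(\tau_M(R),R)$. As $M$ is reflexive, there is an isomorphism $\vartheta:\operatorname{End}_R(M)\to\operatorname{Hom}_R(M\otimes_R M^*,R)$, $\vartheta(f)(m\otimes\alpha)=\alpha(f(m))$. Let $\vartheta_M^*:\operatorname{Hom}_R(\tau_M(R),R)\to\operatorname{Hom}_R(M\otimes_R M^*,R)$ be precomposition with $\vartheta_M: M\otimes_R M^*\to\tau_M(R)$. Define $\sigma=\vartheta^{-1}\circ\vartheta_M^*:\operatorname{End}_R(\tau_M(R))\to\operatorname{End}_R(M)$. *)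

theory Defs
  imports "HOL-Algebra.Algebra"
begin

section \<open>Modules over a commutative ring\<close>

text \<open>
  Module records extend ring records, so they carry a multiplication and a unit that the locale
  \<^locale>\<open>module\<close> ignores; these two fields are left \<^const>\<open>undefined\<close> below. Homomorphisms
  are extensional functions (\<^const>\<open>undefined\<close> off the carrier), so that equality of homomorphisms
  is equality of functions, and a homomorphism into a submodule is literally one into the
  whole module.
\<close>

definition ring_module :: "('a, 'r) ring_scheme \<Rightarrow> ('a, 'a) module" where
  "ring_module R = \<lparr>carrier = carrier R, monoid.mult = monoid.mult R, monoid.one = monoid.one R, ring.zero = ring.zero R, ring.add = ring.add R,
     smult = monoid.mult R\<rparr>"

definition mod_hom ::
  "('a, 'r) ring_scheme \<Rightarrow> ('a, 'b, 'm) module_scheme \<Rightarrow> ('a, 'c, 'n) module_scheme \<Rightarrow> ('b \<Rightarrow> 'c) set"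
  where
  "mod_hom R M N = {f \<in> carrier M \<rightarrow>\<^sub>E carrier N.
     (\<forall>x\<in>carrier M. \<forall>y\<in>carrier M. f (x \<oplus>\<^bsub>M\<^esub> y) = f x \<oplus>\<^bsub>N\<^esub> f y) \<and>
     (\<forall>r\<in>carrier R. \<forall>x\<in>carrier M. f (r \<odot>\<^bsub>M\<^esub> x) = r \<odot>\<^bsub>N\<^esub> f x)}"

definition mod_iso ::
  "('a, 'r) ring_scheme \<Rightarrow> ('a, 'b, 'm) module_scheme \<Rightarrow> ('a, 'c, 'n) module_scheme \<Rightarrow> ('b \<Rightarrow> 'c) set"
  where
  "mod_iso R M N = {f \<in> mod_hom R M N. bij_betw f (carrier M) (carrier N)}"

definition Hom_module ::
  "('a, 'r) ring_scheme \<Rightarrow> ('a, 'b, 'm) module_scheme \<Rightarrow> ('a, 'c, 'n) module_scheme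
     \<Rightarrow> ('a, 'b \<Rightarrow> 'c) module"
  where
  "Hom_module R M N = \<lparr>carrier = mod_hom R M N, monoid.mult = undefined, monoid.one = undefined,
     ring.zero = (\<lambda>x\<in>carrier M. \<zero>\<^bsub>N\<^esub>),
     ring.add = (\<lambda>f g. \<lambda>x\<in>carrier M. f x \<oplus>\<^bsub>N\<^esub> g x),
     smult = (\<lambda>r f. \<lambda>x\<in>carrier M. r \<odot>\<^bsub>N\<^esub> f x)\<rparr>"

definition dual_module ::
  "('a, 'r) ring_scheme \<Rightarrow> ('a, 'b, 'm) module_scheme \<Rightarrow> ('a, 'b \<Rightarrow> 'a) module" where
  "dual_module R M = Hom_module R M (ring_module R)"

definition End_ring ::
  "('a, 'r) ring_scheme \<Rightarrow> ('a, 'b, 'm) module_scheme \<Rightarrow> ('b \<Rightarrow> 'b) ring" where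
  "End_ring R M = \<lparr>carrier = mod_hom R M M,
     monoid.mult = (\<lambda>f g. compose (carrier M) f g),
     monoid.one = (\<lambda>x\<in>carrier M. x),
     ring.zero = (\<lambda>x\<in>carrier M. \<zero>\<^bsub>M\<^esub>),
     ring.add = (\<lambda>f g. \<lambda>x\<in>carrier M. f x \<oplus>\<^bsub>M\<^esub> g x)\<rparr>"

definition ring_center :: "('a, 'r) ring_scheme \<Rightarrow> 'a set" where
  "ring_center S = {z \<in> carrier S. \<forall>s\<in>carrier S. z \<otimes>\<^bsub>S\<^esub> s = s \<otimes>\<^bsub>S\<^esub> z}"

definition mod_span ::
  "('a, 'r) ring_scheme \<Rightarrow> ('a, 'b, 'm) module_scheme \<Rightarrow> 'b set \<Rightarrow> 'b set" where
  "mod_span R M S = \<Inter>{H. submodule H R M \<and> S \<subseteq> H}"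

definition fin_gen_module ::
  "('a, 'r) ring_scheme \<Rightarrow> ('a, 'b, 'm) module_scheme \<Rightarrow> bool" where
  "fin_gen_module R M \<longleftrightarrow> (\<exists>A. finite A \<and> A \<subseteq> carrier M \<and> mod_span R M A = carrier M)"

definition faithful_module ::
  "('a, 'r) ring_scheme \<Rightarrow> ('a, 'b, 'm) module_scheme \<Rightarrow> bool" where
  "faithful_module R M \<longleftrightarrow>
     (\<forall>r\<in>carrier R. (\<forall>x\<in>carrier M. r \<odot>\<^bsub>M\<^esub> x = \<zero>\<^bsub>M\<^esub>) \<longrightarrow> r = \<zero>\<^bsub>R\<^esub>)"

definition evaluation_map ::
  "('a, 'r) ring_scheme \<Rightarrow> ('a, 'b, 'm) module_scheme \<Rightarrow> 'b \<Rightarrow> ('b \<Rightarrow> 'a) \<Rightarrow> 'a" where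
  "evaluation_map R M = (\<lambda>m\<in>carrier M. \<lambda>\<psi>\<in>carrier (dual_module R M). \<psi> m)"

definition reflexive_module ::
  "('a, 'r) ring_scheme \<Rightarrow> ('a, 'b, 'm) module_scheme \<Rightarrow> bool" where
  "reflexive_module R M \<longleftrightarrow>
     evaluation_map R M \<in> mod_iso R M (dual_module R (dual_module R M))"


section \<open>Tensor products\<close>

definition free_module :: "('a, 'r) ring_scheme \<Rightarrow> 'x set \<Rightarrow> ('a, 'x \<Rightarrow> 'a) module" where
  "free_module R S = \<lparr>carrier = {f \<in> S \<rightarrow>\<^sub>E carrier R. finite {x \<in> S. f x \<noteq> \<zero>\<^bsub>R\<^esub>}},
     monoid.mult = undefined, monoid.one = undefined,
     ring.zero = (\<lambda>x\<in>S. \<zero>\<^bsub>R\<^esub>),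
     ring.add = (\<lambda>f g. \<lambda>x\<in>S. f x \<oplus>\<^bsub>R\<^esub> g x),
     smult = (\<lambda>r f. \<lambda>x\<in>S. r \<otimes>\<^bsub>R\<^esub> f x)\<rparr>"

definition free_gen :: "('a, 'r) ring_scheme \<Rightarrow> 'x set \<Rightarrow> 'x \<Rightarrow> 'x \<Rightarrow> 'a" where
  "free_gen R S x = (\<lambda>y\<in>S. if y = x then \<one>\<^bsub>R\<^esub> else \<zero>\<^bsub>R\<^esub>)"

definition quotient_module :: "('a, 'b, 'm) module_scheme \<Rightarrow> 'b set \<Rightarrow> ('a, 'b set) module" where
  "quotient_module M H = \<lparr>carrier = a_rcosets\<^bsub>M\<^esub> H, monoid.mult = undefined, monoid.one = undefined,
     ring.zero = H, ring.add = set_add M,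
     smult = (\<lambda>r C. \<Union>x\<in>C. H +>\<^bsub>M\<^esub> (r \<odot>\<^bsub>M\<^esub> x))\<rparr>"

definition tensor_relations ::
  "('a, 'r) ring_scheme \<Rightarrow> ('a, 'b, 'm) module_scheme \<Rightarrow> ('a, 'c, 'n) module_scheme
     \<Rightarrow> ('b \<times> 'c \<Rightarrow> 'a) set"
  where
  "tensor_relations R M N =
     (let F = free_module R (carrier M \<times> carrier N);
          e = (\<lambda>x y. free_gen R (carrier M \<times> carrier N) (x, y))
      in {e (x \<oplus>\<^bsub>M\<^esub> x') y \<ominus>\<^bsub>F\<^esub> (e x y \<oplus>\<^bsub>F\<^esub> e x' y) | x x' y.
            x \<in> carrier M \<and> x' \<in> carrier M \<and> y \<in> carrier N}
       \<union> {e x (y \<oplus>\<^bsub>N\<^esub> y') \<ominus>\<^bsub>F\<^esub> (e x y \<oplus>\<^bsub>F\<^esub> e x y') | x y y'.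
            x \<in> carrier M \<and> y \<in> carrier N \<and> y' \<in> carrier N}
       \<union> {e (r \<odot>\<^bsub>M\<^esub> x) y \<ominus>\<^bsub>F\<^esub> (r \<odot>\<^bsub>F\<^esub> e x y) | r x y.
            r \<in> carrier R \<and> x \<in> carrier M \<and> y \<in> carrier N}
       \<union> {e x (r \<odot>\<^bsub>N\<^esub> y) \<ominus>\<^bsub>F\<^esub> (r \<odot>\<^bsub>F\<^esub> e x y) | r x y.
            r \<in> carrier R \<and> x \<in> carrier M \<and> y \<in> carrier N})"

definition tensor_null ::
  "('a, 'r) ring_scheme \<Rightarrow> ('a, 'b, 'm) module_scheme \<Rightarrow> ('a, 'c, 'n) module_scheme
     \<Rightarrow> ('b \<times> 'c \<Rightarrow> 'a) set"
  where
  "tensor_null R M N =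
     mod_span R (free_module R (carrier M \<times> carrier N)) (tensor_relations R M N)"

definition tensor_module ::
  "('a, 'r) ring_scheme \<Rightarrow> ('a, 'b, 'm) module_scheme \<Rightarrow> ('a, 'c, 'n) module_scheme
     \<Rightarrow> ('a, ('b \<times> 'c \<Rightarrow> 'a) set) module"
  where
  "tensor_module R M N =
     quotient_module (free_module R (carrier M \<times> carrier N)) (tensor_null R M N)"

definition pure_tensor ::
  "('a, 'r) ring_scheme \<Rightarrow> ('a, 'b, 'm) module_scheme \<Rightarrow> ('a, 'c, 'n) module_scheme
     \<Rightarrow> 'b \<Rightarrow> 'c \<Rightarrow> ('b \<times> 'c \<Rightarrow> 'a) set"
  where
  "pure_tensor R M N x y =
     tensor_null R M N +>\<^bsub>free_module R (carrier M \<times> carrier N)\<^esub>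
       free_gen R (carrier M \<times> carrier N) (x, y)"

text \<open>
  The homomorphism out of the tensor product with prescribed values on pure tensors; by the
  universal property it exists and is unique when \<open>\<beta>\<close> is bilinear.
\<close>

definition tensor_lift ::
  "('a, 'r) ring_scheme \<Rightarrow> ('a, 'b, 'm) module_scheme \<Rightarrow> ('a, 'c, 'n) module_scheme
     \<Rightarrow> ('a, 'd, 'p) module_scheme \<Rightarrow> ('b \<Rightarrow> 'c \<Rightarrow> 'd) \<Rightarrow> ('b \<times> 'c \<Rightarrow> 'a) set \<Rightarrow> 'd"
  where
  "tensor_lift R M N P \<beta> =
     (THE g. g \<in> mod_hom R (tensor_module R M N) P \<and>
        (\<forall>x\<in>carrier M. \<forall>y\<in>carrier N. g (pure_tensor R M N x y) = \<beta> x y))"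


section \<open>The trace ideal and the map \<open>\<sigma>\<close>\<close>

definition trace_ideal ::
  "('a, 'r) ring_scheme \<Rightarrow> ('a, 'b, 'm) module_scheme \<Rightarrow> 'a set" where
  "trace_ideal R M = {(\<Oplus>\<^bsub>R\<^esub>\<alpha>\<in>F. t \<alpha>) | F t.
     finite F \<and> F \<subseteq> carrier (dual_module R M) \<and> (\<forall>\<alpha>\<in>F. t \<alpha> \<in> \<alpha> ` carrier M)}"

definition trace_module ::
  "('a, 'r) ring_scheme \<Rightarrow> ('a, 'b, 'm) module_scheme \<Rightarrow> ('a, 'a) module" where
  "trace_module R M = (ring_module R)\<lparr>carrier := trace_ideal R M\<rparr>"

definition trace_map ::
  "('a, 'r) ring_scheme \<Rightarrow> ('a, 'b, 'm) module_scheme \<Rightarrow> ('b \<times> ('b \<Rightarrow> 'a) \<Rightarrow> 'a) set \<Rightarrow> 'a" where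
  "trace_map R M = tensor_lift R M (dual_module R M) (ring_module R) (\<lambda>m \<alpha>. \<alpha> m)"

definition trace_pullback ::
  "('a, 'r) ring_scheme \<Rightarrow> ('a, 'b, 'm) module_scheme \<Rightarrow> ('a \<Rightarrow> 'a)
     \<Rightarrow> ('b \<times> ('b \<Rightarrow> 'a) \<Rightarrow> 'a) set \<Rightarrow> 'a"
  where
  "trace_pullback R M h =
     compose (carrier (tensor_module R M (dual_module R M))) h (trace_map R M)"

definition theta ::
  "('a, 'r) ring_scheme \<Rightarrow> ('a, 'b, 'm) module_scheme \<Rightarrow> ('b \<Rightarrow> 'b)
     \<Rightarrow> ('b \<times> ('b \<Rightarrow> 'a) \<Rightarrow> 'a) set \<Rightarrow> 'a"
  where
  "theta R M f = tensor_lift R M (dual_module R M) (ring_module R) (\<lambda>m \<alpha>. \<alpha> (f m))"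

text \<open>
  An endomorphism \<open>h\<close> of the trace ideal is, as an extensional function, also a homomorphism
  from the trace ideal to \<open>R\<close>, so no coercion is needed before pulling back.
\<close>

definition sigma ::
  "('a, 'r) ring_scheme \<Rightarrow> ('a, 'b, 'm) module_scheme \<Rightarrow> ('a \<Rightarrow> 'a) \<Rightarrow> 'b \<Rightarrow> 'b" where
  "sigma R M h = inv_into (carrier (End_ring R M)) (theta R M) (trace_pullback R M h)"


section \<open>The total ring of quotients\<close>

text \<open>In the zero ring the element \<open>0\<close> counts as a nonzerodivisor.\<close>

definition nonzerodivisors :: "('a, 'r) ring_scheme \<Rightarrow> 'a set" where
  "nonzerodivisors R =
     {x \<in> carrier R. \<forall>y\<in>carrier R. x \<otimes>\<^bsub>R\<^esub> y = \<zero>\<^bsub>R\<^esub> \<longrightarrow> y = \<zero>\<^bsub>R\<^esub>}"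

definition frac_rel :: "('a, 'r) ring_scheme \<Rightarrow> (('a \<times> 'a) \<times> ('a \<times> 'a)) set" where
  "frac_rel R = {((a, b), (c, d)). a \<in> carrier R \<and> b \<in> nonzerodivisors R \<and>
     c \<in> carrier R \<and> d \<in> nonzerodivisors R \<and> a \<otimes>\<^bsub>R\<^esub> d = c \<otimes>\<^bsub>R\<^esub> b}"

definition fraction :: "('a, 'r) ring_scheme \<Rightarrow> 'a \<Rightarrow> 'a \<Rightarrow> ('a \<times> 'a) set" where
  "fraction R a b = frac_rel R `` {(a, b)}"

definition total_quotient_ring :: "('a, 'r) ring_scheme \<Rightarrow> (('a \<times> 'a) set) ring" where
  "total_quotient_ring R = \<lparr>carrier = (carrier R \<times> nonzerodivisors R) // frac_rel R,
     monoid.mult = (\<lambda>p q. \<Union>(a, b)\<in>p. \<Union>(c, d)\<in>q. fraction R (a \<otimes>\<^bsub>R\<^esub> c) (b \<otimes>\<^bsub>R\<^esub> d)),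
     monoid.one = fraction R \<one>\<^bsub>R\<^esub> \<one>\<^bsub>R\<^esub>,
     ring.zero = fraction R \<zero>\<^bsub>R\<^esub> \<one>\<^bsub>R\<^esub>,
     ring.add = (\<lambda>p q. \<Union>(a, b)\<in>p. \<Union>(c, d)\<in>q.
        fraction R (a \<otimes>\<^bsub>R\<^esub> d \<oplus>\<^bsub>R\<^esub> c \<otimes>\<^bsub>R\<^esub> b) (b \<otimes>\<^bsub>R\<^esub> d))\<rparr>"

definition quot_embed :: "('a, 'r) ring_scheme \<Rightarrow> 'a \<Rightarrow> ('a \<times> 'a) set" where
  "quot_embed R r = fraction R r \<one>\<^bsub>R\<^esub>"

definition frac_stabilizer :: "('a, 'r) ring_scheme \<Rightarrow> 'a set \<Rightarrow> ('a \<times> 'a) set set" where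
  "frac_stabilizer R I = {q \<in> carrier (total_quotient_ring R).
     (\<lambda>t. q \<otimes>\<^bsub>total_quotient_ring R\<^esub> quot_embed R t) ` I \<subseteq> quot_embed R ` I}"

definition End_trace_frac ::
  "('a, 'r) ring_scheme \<Rightarrow> ('a, 'b, 'm) module_scheme \<Rightarrow> ('a \<Rightarrow> 'a) \<Rightarrow> ('a \<times> 'a) set" where
  "End_trace_frac R M h =
     (let x = (SOME x. x \<in> trace_ideal R M \<inter> nonzerodivisors R) in fraction R (h x) x)"

end

theory Submission
  imports Defs
begin

text \<open>
  Reflexivity means that elements of \<open>M\<close> are separated by \<open>M\<^sup>*\<close> and that every functional on \<open>M\<^sup>*\<close> is
  an evaluation. Hence an endomorphism \<open>h\<close> of the trace ideal yields a unique endomorphism \<open>f\<close> of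
  \<open>M\<close> with \<open>\<alpha>(f(m)) = h(\<alpha>(m))\<close> for all \<open>\<alpha>\<close> and \<open>m\<close>, and this \<open>f\<close> is \<open>\<sigma>(h)\<close>; replacing \<open>\<alpha>\<close> by
  \<open>\<alpha> \<circ> g\<close> shows that \<open>f\<close> is central. Conversely, a central \<open>f\<close> commutes with the rank one maps
  \<open>m \<mapsto> \<alpha>(m) n\<close>, which by faithfulness makes \<open>\<alpha>(m) \<mapsto> \<alpha>(f(m))\<close> a well-defined endomorphism of the
  trace ideal. An element annihilating the trace ideal annihilates \<open>M\<close>, so over a Noetherian ring
  the trace ideal contains a nonzerodivisor \<open>x\<close>, and \<open>x h(t) = h(x) t\<close> identifies \<open>h\<close> with \<open>h(x)/x\<close>.
\<close>

section \<open>Nonzerodivisors in ideals of Noetherian rings\<close>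

text \<open>\<open>sigma\<close> is defined through \<open>THE\<close> and \<open>inv_into\<close>
  on a concrete tensor product, a quotient of a free module, so nothing can be said about its values
  before the universal property is available for that construction. Once it is, the tensor product
  drops out: pure tensors generate, hence \<open>\<alpha> (sigma R M h m) = h (\<alpha> m)\<close>
  pins \<open>sigma R M h\<close> down, and identities in M are checked by applying functionals. The
  delicate point in the converse is that an element of the trace ideal has many expressions as a sum
  of values \<open>\<alpha> m\<close>. The assignment
  \<open>\<alpha> m \<mapsto> \<alpha> (f m)\<close> is therefore not defined on representations;
  its value is characterized by how it acts on M. The identity \<open>x h(t) = h(x) t\<close> is
  linearity read twice: both sides are the value of h at the product x t. The same identity gives
  independence of the chosen denominator. Division by b is unambiguous in M because functionals
  carry an equation \<open>b m = b n\<close> into R, where b cancels.\<close>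

definition annihilator :: "('a, 'r) ring_scheme \<Rightarrow> 'a \<Rightarrow> 'a set" where
  "annihilator R c = {x \<in> carrier R. x \<otimes>\<^bsub>R\<^esub> c = \<zero>\<^bsub>R\<^esub>}"

section \<open>Annihilators of elements and prime avoidance\<close>

context cring
begin

lemma annihilator_ideal:
  assumes "c \<in> carrier R"
  shows "ideal (annihilator R c) R"
proof (rule idealI)
  show "subgroup (annihilator R c) (add_monoid R)"
    using assms by (intro add.subgroupI) (auto simp: annihilator_def l_distr l_minus a_inv_def[symmetric])
next
  fix a x assume "a \<in> annihilator R c" and x: "x \<in> carrier R"
  then have a: "a \<in> carrier R" "a \<otimes> c = \<zero>" by (auto simp: annihilator_def)
  then show "x \<otimes> a \<in> annihilator R c"
    using x assms by (auto simp: annihilator_def m_assoc)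
  then show "a \<otimes> x \<in> annihilator R c"
    using a x by (simp add: m_comm)
qed (rule ring_axioms)

text \<open>Choose an element outside P in each of the ideals and multiply: the product lies in all
  of them, and the prime property keeps it outside P.\<close>

lemma ideal_inter_not_in_prime:
  assumes "finite S" and "ideal I R" and "P \<subseteq> carrier R"
    and "\<And>Q. Q \<in> S \<Longrightarrow> ideal Q R"
    and prime: "\<And>x y. \<lbrakk>x \<in> carrier R; y \<in> carrier R; x \<otimes> y \<in> P\<rbrakk> \<Longrightarrow> x \<in> P \<or> y \<in> P"
    and "\<not> I \<subseteq> P" and "\<And>Q. Q \<in> S \<Longrightarrow> \<not> Q \<subseteq> P"
  shows "\<exists>y\<in>I. (\<forall>Q\<in>S. y \<in> Q) \<and> y \<notin> P"
  using assms(1,4,7)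
proof (induction S)
  case empty
  then show ?case using \<open>\<not> I \<subseteq> P\<close> by auto
next
  case (insert Q S)
  obtain y where y: "y \<in> I" "\<forall>Q\<in>S. y \<in> Q" "y \<notin> P"
    using insert by auto
  obtain z where z: "z \<in> Q" "z \<notin> P" using insert.prems by blast
  have carr: "y \<in> carrier R" "z \<in> carrier R"
    using y z ideal.Icarr[OF \<open>ideal I R\<close>] ideal.Icarr[of Q R] insert.prems by auto
  have "y \<otimes> z \<in> I" using y carr ideal.I_r_closed[OF \<open>ideal I R\<close>] by auto
  moreover have "y \<otimes> z \<in> Q" using z carr insert.prems(1)[of Q] ideal.I_l_closed by fastforce
  moreover have "y \<otimes> z \<in> Q'" if "Q' \<in> S" for Q'
    using y carr that insert.prems(1)[of Q'] ideal.I_r_closed by fastforce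
  moreover have "y \<otimes> z \<notin> P" using prime[OF carr] y z by auto
  ultimately show ?case by blast
qed

text \<open>If the x found for S happens to lie in the new P, correct it by some y in I that lies in
  every member of S but not in P. Then \<open>x \<oplus> y\<close> avoids P because only x lies in
  P, and avoids each Q in S because only y lies in Q. Incomparability is what provides y: no Q in S
  is contained in P.\<close>

lemma prime_avoidance_incomparable:
  assumes "finite S" and I: "ideal I R"
    and "\<And>P. P \<in> S \<Longrightarrow> ideal P R"
    and "\<And>P x y. \<lbrakk>P \<in> S; x \<in> carrier R; y \<in> carrier R; x \<otimes> y \<in> P\<rbrakk> \<Longrightarrow> x \<in> P \<or> y \<in> P"
    and "\<And>P Q. \<lbrakk>P \<in> S; Q \<in> S; P \<subseteq> Q\<rbrakk> \<Longrightarrow> P = Q"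
    and "\<And>P. P \<in> S \<Longrightarrow> \<not> I \<subseteq> P"
  shows "\<exists>x\<in>I. \<forall>P\<in>S. x \<notin> P"
  using assms(1,3-)
proof (induction S)
  case empty
  then show ?case using additive_subgroup.zero_closed[OF ideal.axioms(1)[OF I]] by auto
next
  case (insert P S)
  have "\<exists>x\<in>I. \<forall>P\<in>S. x \<notin> P"
  proof (rule insert.IH)
    show "x \<in> Q \<or> y \<in> Q" if "Q \<in> S" "x \<in> carrier R" "y \<in> carrier R" "x \<otimes> y \<in> Q" for Q x y
      using insert.prems(2)[of Q x y] that by blast
  qed (use insert.prems in auto)
  then obtain x where x: "x \<in> I" "\<forall>P\<in>S. x \<notin> P" by blast
  show ?case
  proof (cases "x \<in> P")
    case False
    then show ?thesis using x by auto
  next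
    case True
    have "\<exists>y\<in>I. (\<forall>Q\<in>S. y \<in> Q) \<and> y \<notin> P"
    proof (rule ideal_inter_not_in_prime[OF \<open>finite S\<close> I])
      show "P \<subseteq> carrier R" using insert.prems(1)[of P] ideal.Icarr by fastforce
      show "\<not> Q \<subseteq> P" if "Q \<in> S" for Q
        using insert.prems(3)[of Q P] insert.hyps that by blast
    qed (use insert.prems(1,2,4) in blast)+
    then obtain y where y: "y \<in> I" "\<forall>Q\<in>S. y \<in> Q" "y \<notin> P" by blast
    have carr: "x \<in> carrier R" "y \<in> carrier R" using x y ideal.Icarr[OF I] by auto
    have cancel: "a \<in> Q" if "ideal Q R" "b \<in> Q" "a \<oplus> b \<in> Q" "a \<in> carrier R" "b \<in> carrier R" for a b Q
    proof -
      interpret Q: ideal Q R by fact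
      have "(a \<oplus> b) \<oplus> \<ominus> b \<in> Q" using that by auto
      moreover have "(a \<oplus> b) \<oplus> \<ominus> b = a" using that by algebra
      ultimately show ?thesis by simp
    qed
    have "x \<oplus> y \<in> I"
      using x(1) y(1) additive_subgroup.a_closed[OF ideal.axioms(1)[OF I]] by blast
    moreover have "x \<oplus> y \<notin> P"
    proof
      assume "x \<oplus> y \<in> P"
      then have "y \<oplus> x \<in> P" using a_comm[OF carr] by simp
      then have "y \<in> P" using cancel[of P x y] True carr insert.prems(1)[of P] by blast
      then show False using y(3) by blast
    qed
    moreover have "x \<oplus> y \<notin> Q" if "Q \<in> S" for Q
    proof
      assume "x \<oplus> y \<in> Q"
      then have "x \<in> Q" using cancel[of Q y x] y(2) that carr insert.prems(1)[of Q] by blast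
      then show False using x(2) that by blast
    qed
    ultimately show ?thesis by blast
  qed
qed

text \<open>If y does not kill c, then \<open>y \<otimes> c\<close> is nonzero and everything
  killing c kills it, so by maximality both have the same annihilator. Since x kills
  \<open>y \<otimes> c\<close>, it also kills c.\<close>

lemma maximal_annihilator_prime:
  assumes c: "c \<in> carrier R" "c \<noteq> \<zero>"
    and max: "\<And>d. \<lbrakk>d \<in> carrier R; d \<noteq> \<zero>; annihilator R c \<subseteq> annihilator R d\<rbrakk>
        \<Longrightarrow> annihilator R d = annihilator R c"
    and xy: "x \<in> carrier R" "y \<in> carrier R" "x \<otimes> y \<in> annihilator R c"
  shows "x \<in> annihilator R c \<or> y \<in> annihilator R c"
proof (rule disjCI)
  assume "y \<notin> annihilator R c"
  then have "y \<otimes> c \<noteq> \<zero>" using xy by (auto simp: annihilator_def)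
  moreover have "annihilator R c \<subseteq> annihilator R (y \<otimes> c)"
    unfolding annihilator_def using c xy m_lcomm[of _ y c] by auto
  ultimately have "annihilator R (y \<otimes> c) = annihilator R c"
    using max[of "y \<otimes> c"] c xy by auto
  moreover have "x \<in> annihilator R (y \<otimes> c)"
    using c xy by (auto simp: annihilator_def m_assoc)
  ultimately show "x \<in> annihilator R c" by auto
qed

end

text \<open>Zorn applies to an arbitrary nonempty family of ideals because the chain condition makes
  the union of a nonempty chain a member of that chain, so the union cannot leave the
  family.\<close>

lemma (in noetherian_ring) maximal_ideal_exists:
  assumes "\<A> \<noteq> {}" and "\<And>I. I \<in> \<A> \<Longrightarrow> ideal I R"
  obtains I where "I \<in> \<A>" "\<And>J. \<lbrakk>J \<in> \<A>; I \<subseteq> J\<rbrakk> \<Longrightarrow> J = I"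
proof -
  have "\<exists>I\<in>\<A>. \<forall>J\<in>\<A>. I \<subseteq> J \<longrightarrow> J = I"
  proof (rule subset_Zorn_nonempty)
    fix C assume C: "C \<noteq> {}" "subset.chain \<A> C"
    then have "subset.chain {I. ideal I R} C"
      using assms(2) by (auto simp: pred_on.chain_def)
    then show "\<Union>C \<in> \<A>"
      using ideal_chain_is_trivial[OF C(1)] C(2) by (auto simp: pred_on.chain_def)
  qed (use assms in auto)
  then show thesis using that by blast
qed

text \<open>A maximal ideal among those generated by finite subsets of C already contains all of C,
  and whatever kills its generators kills the whole ideal. This is the source of finiteness for the
  maximal annihilators.\<close>

lemma (in cring) finite_annihilators_suffice:
  assumes "noetherian_ring R" and C: "C \<subseteq> carrier R"
  obtains F where "finite F" "F \<subseteq> C"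
    "\<forall>c\<in>C. carrier R \<inter> (\<Inter>d\<in>F. annihilator R d) \<subseteq> annihilator R c"
proof -
  interpret noetherian_ring R by fact
  define \<A> where "\<A> = {Idl F | F. finite F \<and> F \<subseteq> C}"
  have "\<A> \<noteq> {}" unfolding \<A>_def by auto
  moreover have "ideal I R" if "I \<in> \<A>" for I
    using that C genideal_ideal unfolding \<A>_def by blast
  ultimately obtain I where I: "I \<in> \<A>" "\<And>J. \<lbrakk>J \<in> \<A>; I \<subseteq> J\<rbrakk> \<Longrightarrow> J = I"
    using maximal_ideal_exists by metis
  then obtain F where F: "I = Idl F" "finite F" "F \<subseteq> C" unfolding \<A>_def by blast
  show thesis
  proof (intro that[OF F(2,3)] ballI subsetI)
    fix c x assume c: "c \<in> C" and "x \<in> carrier R \<inter> (\<Inter>d\<in>F. annihilator R d)"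
    then have x: "x \<in> carrier R" "\<And>d. d \<in> F \<Longrightarrow> x \<in> annihilator R d" by auto
    have sub: "insert c F \<subseteq> carrier R" using c F C by auto
    have "Idl (insert c F) \<in> \<A>" using c F unfolding \<A>_def by blast
    moreover have "I \<subseteq> Idl (insert c F)"
      unfolding F(1) by (rule genideal_minimal[OF genideal_ideal[OF sub]]) (use genideal_self[OF sub] in auto)
    ultimately have "c \<in> Idl F" using I(2) genideal_self[OF sub] F(1) by blast
    \<comment> \<open>Killing is symmetric: that x kills F says that F lies in the ideal
      \<open>annihilator R x\<close>, which then contains everything F generates.\<close>
    moreover have "Idl F \<subseteq> annihilator R x"
    proof (rule genideal_minimal[OF annihilator_ideal[OF x(1)]])
      show "F \<subseteq> annihilator R x"
        using x sub by (simp add: annihilator_def subset_eq) (metis m_comm)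
    qed
    ultimately show "x \<in> annihilator R c"
      using x sub by (auto simp: annihilator_def m_comm)
  qed
qed

text \<open>
  Every zero divisor lies in a maximal annihilator; these are prime and, by the ascending chain
  condition, finite in number, so prime avoidance applies.
\<close>

lemma (in cring) noetherian_ideal_has_nonzerodivisor:
  assumes noeth: "noetherian_ring R" and I: "ideal I R"
    and ann: "\<And>c. \<lbrakk>c \<in> carrier R; \<And>x. x \<in> I \<Longrightarrow> x \<otimes> c = \<zero>\<rbrakk> \<Longrightarrow> c = \<zero>"
  shows "I \<inter> nonzerodivisors R \<noteq> {}"
proof
  assume no: "I \<inter> nonzerodivisors R = {}"
  \<comment> \<open>C collects elements rather than ideals: nonzero elements whose annihilator is
    maximal among annihilators of nonzero elements. In this form a finite F can be extracted from
    C.\<close>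
  define C where "C = {c \<in> carrier R. c \<noteq> \<zero> \<and>
    (\<forall>d\<in>carrier R. d \<noteq> \<zero> \<longrightarrow> annihilator R c \<subseteq> annihilator R d \<longrightarrow> annihilator R d = annihilator R c)}"
  have prime: "x \<in> annihilator R c \<or> y \<in> annihilator R c"
    if "c \<in> C" "x \<in> carrier R" "y \<in> carrier R" "x \<otimes> y \<in> annihilator R c" for c x y
    using that unfolding C_def by (intro maximal_annihilator_prime) auto
  have CR: "C \<subseteq> carrier R" unfolding C_def by blast
  obtain F where F: "finite F" "F \<subseteq> C"
    "\<forall>c\<in>C. carrier R \<inter> (\<Inter>d\<in>F. annihilator R d) \<subseteq> annihilator R c"
    by (rule finite_annihilators_suffice[OF noeth CR])
  define S where "S = annihilator R ` F"
  have ideal: "ideal P R" if "P \<in> S" for P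
    using that F(2) annihilator_ideal unfolding S_def C_def by auto
  \<comment> \<open>Maximal annihilators are incomparable. Q ranges over all of C and not just over
    F, since the annihilator of a further element of C has to be recognized as a member of S
    below.\<close>
  have eq: "P = Q" if "P \<in> S" "Q \<in> annihilator R ` C" "P \<subseteq> Q" for P Q
    using that F(2) unfolding S_def C_def by fastforce
  have "\<exists>x\<in>I. \<forall>P\<in>S. x \<notin> P"
  proof (rule prime_avoidance_incomparable[OF _ I ideal])
    show "finite S" using F unfolding S_def by auto
    show "P = Q" if "P \<in> S" "Q \<in> S" "P \<subseteq> Q" for P Q
      using eq that F(2) unfolding S_def by blast
    show "x \<in> P \<or> y \<in> P" if "P \<in> S" "x \<in> carrier R" "y \<in> carrier R" "x \<otimes> y \<in> P" for P x y
      using that prime F(2) unfolding S_def by blast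
    show "\<not> I \<subseteq> P" if "P \<in> S" for P
    proof
      assume "I \<subseteq> P"
      from that obtain c where "c \<in> C" "P = annihilator R c" using F(2) unfolding S_def by blast
      with \<open>I \<subseteq> P\<close> ann[of c] show False unfolding C_def annihilator_def by blast
    qed
  qed
  then obtain x where x: "x \<in> I" "\<And>P. P \<in> S \<Longrightarrow> x \<notin> P" by blast
  have xR: "x \<in> carrier R" using x ideal.Icarr[OF I] by auto
  with x no obtain y where y: "y \<in> carrier R" "x \<otimes> y = \<zero>" "y \<noteq> \<zero>"
    unfolding nonzerodivisors_def by blast
  \<comment> \<open>Annihilators of nonzero elements that contain the zero divisor x. A maximal one
    among these is maximal among all annihilators of nonzero elements, because a larger one still
    contains x.\<close>
  define \<A> where "\<A> = {annihilator R c | c. c \<in> carrier R \<and> c \<noteq> \<zero> \<and> x \<in> annihilator R c}"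
  have "\<A> \<noteq> {}" using xR y unfolding \<A>_def by (auto simp: annihilator_def)
  moreover have "ideal J R" if "J \<in> \<A>" for J
    using that annihilator_ideal unfolding \<A>_def by auto
  ultimately obtain J where J: "J \<in> \<A>" "\<And>J'. \<lbrakk>J' \<in> \<A>; J \<subseteq> J'\<rbrakk> \<Longrightarrow> J' = J"
    using noetherian_ring.maximal_ideal_exists[OF noeth] by metis
  then obtain c where c: "J = annihilator R c" "c \<in> carrier R" "c \<noteq> \<zero>" "x \<in> annihilator R c"
    unfolding \<A>_def by blast
  have "c \<in> C"
    unfolding C_def
  proof (intro CollectI conjI ballI impI c)
    fix d assume d: "d \<in> carrier R" "d \<noteq> \<zero>" "annihilator R c \<subseteq> annihilator R d"
    then have "annihilator R d \<in> \<A>" using c unfolding \<A>_def by blast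
    then show "annihilator R d = annihilator R c" using J(2) c d by auto
  qed
  \<comment> \<open>By the choice of F the intersection of S lies in the prime
    \<open>annihilator R c\<close>, so one member of S does. Maximality makes the two equal, and
    then x lies in a member of S although it was chosen to avoid them all.\<close>
  have "\<exists>P\<in>S. P \<subseteq> annihilator R c"
  proof (rule ccontr)
    assume contra: "\<not> (\<exists>P\<in>S. P \<subseteq> annihilator R c)"
    have "\<exists>y\<in>carrier R. (\<forall>Q\<in>S. y \<in> Q) \<and> y \<notin> annihilator R c"
    proof (rule ideal_inter_not_in_prime[OF _ oneideal _ ideal prime[OF \<open>c \<in> C\<close>]])
      show "finite S" using F unfolding S_def by auto
      show "\<not> carrier R \<subseteq> annihilator R c"
        using subsetD[of "carrier R" "annihilator R c" \<one>] c(2,3) by (auto simp: annihilator_def)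
      show "annihilator R c \<subseteq> carrier R" by (auto simp: annihilator_def)
      show "\<not> Q \<subseteq> annihilator R c" if "Q \<in> S" for Q using contra that by blast
    qed
    then obtain y where y: "y \<in> carrier R" "\<forall>Q\<in>S. y \<in> Q" "y \<notin> annihilator R c" by blast
    then have "y \<in> carrier R \<inter> (\<Inter>d\<in>F. annihilator R d)" unfolding S_def by simp
    with bspec[OF F(3) \<open>c \<in> C\<close>] have "y \<in> annihilator R c" by (rule subsetD)
    then show False using y(3) by contradiction
  qed
  then obtain P where P: "P \<in> S" "P \<subseteq> annihilator R c" by blast
  then have "P = annihilator R c" using eq \<open>c \<in> C\<close> by blast
  then show False using x(2)[OF P(1)] c by auto
qed

section \<open>Homomorphisms and free modules\<close>

lemma mod_homI:
  assumes "f \<in> carrier M \<rightarrow>\<^sub>E carrier N"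
    and "\<And>x y. \<lbrakk>x \<in> carrier M; y \<in> carrier M\<rbrakk> \<Longrightarrow> f (x \<oplus>\<^bsub>M\<^esub> y) = f x \<oplus>\<^bsub>N\<^esub> f y"
    and "\<And>r x. \<lbrakk>r \<in> carrier R; x \<in> carrier M\<rbrakk> \<Longrightarrow> f (r \<odot>\<^bsub>M\<^esub> x) = r \<odot>\<^bsub>N\<^esub> f x"
  shows "f \<in> mod_hom R M N"
  using assms by (simp add: mod_hom_def)

lemma mod_hom_closed: "\<lbrakk>f \<in> mod_hom R M N; x \<in> carrier M\<rbrakk> \<Longrightarrow> f x \<in> carrier N"
  by (auto simp: mod_hom_def)

lemma mod_hom_add:
  "\<lbrakk>f \<in> mod_hom R M N; x \<in> carrier M; y \<in> carrier M\<rbrakk> \<Longrightarrow> f (x \<oplus>\<^bsub>M\<^esub> y) = f x \<oplus>\<^bsub>N\<^esub> f y"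
  by (auto simp: mod_hom_def)

lemma mod_hom_smult:
  "\<lbrakk>f \<in> mod_hom R M N; r \<in> carrier R; x \<in> carrier M\<rbrakk> \<Longrightarrow> f (r \<odot>\<^bsub>M\<^esub> x) = r \<odot>\<^bsub>N\<^esub> f x"
  by (auto simp: mod_hom_def)

lemma mod_hom_eqI:
  "\<lbrakk>f \<in> mod_hom R M N; g \<in> mod_hom R M N; \<And>x. x \<in> carrier M \<Longrightarrow> f x = g x\<rbrakk> \<Longrightarrow> f = g"
  by (auto simp: mod_hom_def intro: PiE_ext)

lemma mod_hom_zero:
  assumes "module R M" "module R N" "f \<in> mod_hom R M N"
  shows "f \<zero>\<^bsub>M\<^esub> = \<zero>\<^bsub>N\<^esub>"
proof -
  interpret M: module R M by fact
  interpret N: module R N by fact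
  have "f (\<zero>\<^bsub>R\<^esub> \<odot>\<^bsub>M\<^esub> \<zero>\<^bsub>M\<^esub>) = \<zero>\<^bsub>R\<^esub> \<odot>\<^bsub>N\<^esub> f \<zero>\<^bsub>M\<^esub>"
    by (rule mod_hom_smult[OF assms(3)]) auto
  then show ?thesis using mod_hom_closed[OF assms(3) M.M.zero_closed] by simp
qed

lemma mod_hom_uminus:
  assumes "module R M" "module R N" "f \<in> mod_hom R M N" "x \<in> carrier M"
  shows "f (\<ominus>\<^bsub>M\<^esub> x) = \<ominus>\<^bsub>N\<^esub> f x"
proof -
  interpret M: module R M by fact
  interpret N: module R N by fact
  have fx: "f x \<in> carrier N" "f (\<ominus>\<^bsub>M\<^esub> x) \<in> carrier N"
    using assms(3,4) by (auto intro: mod_hom_closed)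
  have "f (\<ominus>\<^bsub>M\<^esub> x) \<oplus>\<^bsub>N\<^esub> f x = f (\<ominus>\<^bsub>M\<^esub> x \<oplus>\<^bsub>M\<^esub> x)"
    using assms(3,4) by (simp add: mod_hom_add)
  also have "\<dots> = \<zero>\<^bsub>N\<^esub>" using assms by (simp add: M.M.l_neg mod_hom_zero)
  finally show ?thesis using fx N.M.minus_equality by metis
qed

lemma mod_hom_minus:
  assumes "module R M" "module R N" "f \<in> mod_hom R M N" "x \<in> carrier M" "y \<in> carrier M"
  shows "f (x \<ominus>\<^bsub>M\<^esub> y) = f x \<ominus>\<^bsub>N\<^esub> f y"
proof -
  interpret M: module R M by fact
  show ?thesis using assms by (simp add: a_minus_def mod_hom_add mod_hom_uminus)
qed

text \<open>Lets vanishing on generators pass to their span: a kernel that contains the tensor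
  relations contains \<open>tensor_null\<close>.\<close>

lemma mod_hom_kernel_submodule:
  assumes "module R M" "module R N" "f \<in> mod_hom R M N"
  shows "submodule {x \<in> carrier M. f x = \<zero>\<^bsub>N\<^esub>} R M"
proof -
  interpret M: module R M by fact
  interpret N: module R N by fact
  show ?thesis
    by (rule M.submoduleI) (auto simp: mod_hom_zero[OF assms] mod_hom_uminus[OF assms]
        mod_hom_add[OF assms(3)] mod_hom_smult[OF assms(3)])
qed

lemma mod_span_submodule:
  assumes "module R M" "A \<subseteq> carrier M"
  shows "submodule (mod_span R M A) R M"
proof -
  interpret M: module R M by fact
  show ?thesis
  proof (rule M.submoduleI)
    show "mod_span R M A \<subseteq> carrier M"
      using M.carrier_is_submodule assms(2) by (auto simp: mod_span_def)
    show "\<zero>\<^bsub>M\<^esub> \<in> mod_span R M A"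
      by (auto simp: mod_span_def submodule_def dest: subgroup.one_closed)
  qed (use M.submoduleE in \<open>fastforce simp: mod_span_def\<close>)+
qed

lemma mod_span_minimal: "\<lbrakk>submodule H R M; A \<subseteq> H\<rbrakk> \<Longrightarrow> mod_span R M A \<subseteq> H"
  by (auto simp: mod_span_def)

lemma ring_module_simps [simp]:
  "carrier (ring_module R) = carrier R" "\<zero>\<^bsub>ring_module R\<^esub> = \<zero>\<^bsub>R\<^esub>"
  "x \<oplus>\<^bsub>ring_module R\<^esub> y = x \<oplus>\<^bsub>R\<^esub> y" "r \<odot>\<^bsub>ring_module R\<^esub> x = r \<otimes>\<^bsub>R\<^esub> x"
  by (simp_all add: ring_module_def)

lemma (in cring) ring_module_module: "module R (ring_module R)"
proof (rule moduleI)
  show "abelian_group (ring_module R)"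
    by (rule abelian_groupI) (auto simp: a_ac intro: l_neg[of x for x] bexI[of _ "\<ominus> x" for x])
qed (auto simp: l_distr r_distr m_assoc is_cring)

lemma free_module_simps:
  "carrier (free_module R S) = {f \<in> S \<rightarrow>\<^sub>E carrier R. finite {x \<in> S. f x \<noteq> \<zero>\<^bsub>R\<^esub>}}"
  "\<zero>\<^bsub>free_module R S\<^esub> = (\<lambda>x\<in>S. \<zero>\<^bsub>R\<^esub>)"
  "f \<oplus>\<^bsub>free_module R S\<^esub> g = (\<lambda>x\<in>S. f x \<oplus>\<^bsub>R\<^esub> g x)"
  "r \<odot>\<^bsub>free_module R S\<^esub> f = (\<lambda>x\<in>S. r \<otimes>\<^bsub>R\<^esub> f x)"
  by (simp_all add: free_module_def)

lemma free_module_eqI: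
  "\<lbrakk>f \<in> carrier (free_module R S); g \<in> carrier (free_module R S); \<And>x. x \<in> S \<Longrightarrow> f x = g x\<rbrakk> \<Longrightarrow> f = g"
  by (auto simp: free_module_simps intro: PiE_ext)

section \<open>Free modules and induction on the support\<close>

context cring
begin

lemma free_module_zero_closed: "\<zero>\<^bsub>free_module R S\<^esub> \<in> carrier (free_module R S)"
  by (auto simp: free_module_simps)

lemma free_module_add_closed:
  assumes "f \<in> carrier (free_module R S)" "g \<in> carrier (free_module R S)"
  shows "f \<oplus>\<^bsub>free_module R S\<^esub> g \<in> carrier (free_module R S)"
proof -
  have "finite {x \<in> S. (if x \<in> S then f x \<oplus> g x else undefined) \<noteq> \<zero>}"
    by (rule finite_subset[of _ "{x \<in> S. f x \<noteq> \<zero>} \<union> {x \<in> S. g x \<noteq> \<zero>}"])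
       (use assms in \<open>auto simp: free_module_simps\<close>)
  then show ?thesis using assms by (auto simp: free_module_simps)
qed

lemma free_module_smult_closed:
  assumes "r \<in> carrier R" "f \<in> carrier (free_module R S)"
  shows "r \<odot>\<^bsub>free_module R S\<^esub> f \<in> carrier (free_module R S)"
proof -
  have "finite {x \<in> S. (if x \<in> S then r \<otimes> f x else undefined) \<noteq> \<zero>}"
    by (rule finite_subset[of _ "{x \<in> S. f x \<noteq> \<zero>}"])
       (use assms in \<open>auto simp: free_module_simps\<close>)
  then show ?thesis using assms by (auto simp: free_module_simps)
qed

lemma free_module_module: "module R (free_module R S)"
proof -
  let ?F = "free_module R S"
  have val: "f x \<in> carrier R" if "f \<in> carrier ?F" "x \<in> S" for f x
    using that by (auto simp: free_module_simps)
  have app: "(f \<oplus>\<^bsub>?F\<^esub> g) x = f x \<oplus> g x" "(r \<odot>\<^bsub>?F\<^esub> f) x = r \<otimes> f x" "\<zero>\<^bsub>?F\<^esub> x = \<zero>"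
    if "x \<in> S" for f g r x using that by (simp_all add: free_module_simps)
  note closed = free_module_add_closed free_module_smult_closed free_module_zero_closed
  have "abelian_group ?F"
  proof (rule abelian_groupI)
    fix f assume f: "f \<in> carrier ?F"
    \<comment> \<open>Taking the negative as a scalar multiple gives it finite support by
      \<open>free_module_smult_closed\<close>.\<close>
    have "(\<ominus> \<one> \<odot>\<^bsub>?F\<^esub> f) \<oplus>\<^bsub>?F\<^esub> f = \<zero>\<^bsub>?F\<^esub>"
      by (rule free_module_eqI[of _ R S]) (simp_all add: f closed app val l_minus l_neg)
    moreover have "\<ominus> \<one> \<odot>\<^bsub>?F\<^esub> f \<in> carrier ?F" by (simp add: f closed)
    ultimately show "\<exists>g\<in>carrier ?F. g \<oplus>\<^bsub>?F\<^esub> f = \<zero>\<^bsub>?F\<^esub>" by blast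
  qed (simp_all add: closed, (rule free_module_eqI[of _ R S]; simp add: closed app val a_ac)+)
  then show ?thesis
    by (intro moduleI)
       (simp_all add: is_cring closed, (rule free_module_eqI[of _ R S]; simp add: closed app val l_distr r_distr m_assoc)+)
qed

lemma free_gen_closed: "x \<in> S \<Longrightarrow> free_gen R S x \<in> carrier (free_module R S)"
  by (auto simp: free_gen_def free_module_simps intro: finite_subset[of _ "{x}"])

text \<open>Induction on the size of the support, peeling off one basis element at a time. Its image
  in the quotient is the induction over sums of multiples of pure tensors.\<close>

lemma free_module_induct [consumes 1, case_names zero add]:
  assumes f: "f \<in> carrier (free_module R S)"
    and zero: "Q \<zero>\<^bsub>free_module R S\<^esub>"
    and add: "\<And>g r s. \<lbrakk>g \<in> carrier (free_module R S); r \<in> carrier R; s \<in> S; Q g\<rbrakk> \<Longrightarrow>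
      Q (g \<oplus>\<^bsub>free_module R S\<^esub> r \<odot>\<^bsub>free_module R S\<^esub> free_gen R S s)"
  shows "Q f"
proof -
  have "finite {s \<in> S. f s \<noteq> \<zero>}" using f by (simp add: free_module_simps)
  then show ?thesis
    using f
  proof (induction "{s \<in> S. f s \<noteq> \<zero>}" arbitrary: f rule: finite_induct)
    case empty
    have "f = \<zero>\<^bsub>free_module R S\<^esub>"
    proof (rule free_module_eqI[OF empty.prems free_module_zero_closed])
      fix x assume x: "x \<in> S"
      then have "f x = \<zero>" using empty.hyps by blast
      with x show "f x = \<zero>\<^bsub>free_module R S\<^esub> x" by (simp add: free_module_simps)
    qed
    then show ?case using zero by simp
  next
    case (insert s A)
    have "s \<in> {t \<in> S. f t \<noteq> \<zero>}" unfolding insert.hyps(4)[symmetric] by simp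
    then have s: "s \<in> S" by simp
    have fs: "f s \<in> carrier R" using s insert.prems by (auto simp: free_module_simps)
    \<comment> \<open>Switching off the coordinate s leaves exactly A as support; the function stays
      extensional because s lies in S.\<close>
    define g where "g = f(s := \<zero>)"
    have supp: "A = {t \<in> S. g t \<noteq> \<zero>}" using insert.hyps(2,4) unfolding g_def by auto
    then have g: "g \<in> carrier (free_module R S)"
      using insert.prems insert.hyps(1) s unfolding g_def
      by (auto simp: free_module_simps PiE_iff extensional_def)
    have "f = g \<oplus>\<^bsub>free_module R S\<^esub> f s \<odot>\<^bsub>free_module R S\<^esub> free_gen R S s"
    proof (rule free_module_eqI[OF insert.prems])
      show "g \<oplus>\<^bsub>free_module R S\<^esub> f s \<odot>\<^bsub>free_module R S\<^esub> free_gen R S s \<in> carrier (free_module R S)"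
        by (intro free_module_add_closed free_module_smult_closed free_gen_closed g fs s)
      fix x assume x: "x \<in> S"
      then have "f x \<in> carrier R" using insert.prems by (auto simp: free_module_simps)
      with x fs show "f x = (g \<oplus>\<^bsub>free_module R S\<^esub> f s \<odot>\<^bsub>free_module R S\<^esub> free_gen R S s) x"
        by (simp add: free_module_simps free_gen_def g_def)
    qed
    then show ?case using add[OF g fs s insert.hyps(3)[OF supp g]] by simp
  qed
qed

end

text \<open>The linear extension of b to the free module. The sum runs over the support only, since
  the index set S is a whole product of carriers and may be infinite.\<close>

definition free_lift ::
  "('a, 'r) ring_scheme \<Rightarrow> 'x set \<Rightarrow> ('a, 'c, 'n) module_scheme \<Rightarrow> ('x \<Rightarrow> 'c) \<Rightarrow> ('x \<Rightarrow> 'a) \<Rightarrow> 'c"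
  where
  "free_lift R S P b =
     (\<lambda>f\<in>carrier (free_module R S). \<Oplus>\<^bsub>P\<^esub>s\<in>{s \<in> S. f s \<noteq> \<zero>\<^bsub>R\<^esub>}. f s \<odot>\<^bsub>P\<^esub> b s)"

context module
begin

text \<open>Supports change with the function, and cancellation can shrink the support of a sum.
  Summing over one common finite superset makes the values at f, at g and at their sum comparable,
  as the extra terms vanish.\<close>

lemma free_lift_superset:
  assumes "f \<in> carrier (free_module R S)" "b \<in> S \<rightarrow> carrier M"
    and "finite A" "{s \<in> S. f s \<noteq> \<zero>} \<subseteq> A" "A \<subseteq> S"
  shows "free_lift R S M b f = (\<Oplus>\<^bsub>M\<^esub>s\<in>A. f s \<odot>\<^bsub>M\<^esub> b s)"
proof -
  have fR: "f s \<in> carrier R" if "s \<in> S" for s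
    using assms(1) that by (auto simp: free_module_simps)
  have "(\<Oplus>\<^bsub>M\<^esub>s\<in>{s \<in> S. f s \<noteq> \<zero>}. f s \<odot>\<^bsub>M\<^esub> b s) = (\<Oplus>\<^bsub>M\<^esub>s\<in>A. f s \<odot>\<^bsub>M\<^esub> b s)"
  proof (rule M.add.finprod_mono_neutral_cong_left[OF assms(3,4)])
    show "f i \<odot>\<^bsub>M\<^esub> b i = \<zero>\<^bsub>M\<^esub>" if "i \<in> A - {s \<in> S. f s \<noteq> \<zero>}" for i
      using assms(2,5) that by (auto simp: Pi_iff)
    show "(\<lambda>s. f s \<odot>\<^bsub>M\<^esub> b s) \<in> A \<rightarrow> carrier M"
      using assms(2,5) fR by (auto simp: Pi_iff)
  qed auto
  then show ?thesis using assms(1) by (simp add: free_lift_def)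
qed

lemma free_lift_hom:
  assumes b: "b \<in> S \<rightarrow> carrier M"
  shows "free_lift R S M b \<in> mod_hom R (free_module R S) M"
proof (rule mod_homI)
  interpret F: module R "free_module R S" by (rule free_module_module)
  have fR: "f s \<in> carrier R" if "f \<in> carrier (free_module R S)" "s \<in> S" for f s
    using that by (auto simp: free_module_simps)
  have bM: "b s \<in> carrier M" if "s \<in> S" for s using b that by blast
  have fin: "finite {s \<in> S. f s \<noteq> \<zero>}" if "f \<in> carrier (free_module R S)" for f
    using that by (simp add: free_module_simps)
  show "free_lift R S M b \<in> carrier (free_module R S) \<rightarrow>\<^sub>E carrier M"
    unfolding free_lift_def by (auto intro!: M.finsum_closed simp: fR bM)
  fix f assume f: "f \<in> carrier (free_module R S)"
  {
    fix g assume g: "g \<in> carrier (free_module R S)"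
    let ?A = "{s \<in> S. f s \<noteq> \<zero>} \<union> {s \<in> S. g s \<noteq> \<zero>}"
    have A: "finite ?A" "?A \<subseteq> S" using f g fin by auto
    have "free_lift R S M b (f \<oplus>\<^bsub>free_module R S\<^esub> g)
        = (\<Oplus>\<^bsub>M\<^esub>s\<in>?A. (f \<oplus>\<^bsub>free_module R S\<^esub> g) s \<odot>\<^bsub>M\<^esub> b s)"
      by (rule free_lift_superset[OF F.M.a_closed[OF f g] b A(1) _ A(2)])
         (auto simp: free_module_simps)
    also have "\<dots> = (\<Oplus>\<^bsub>M\<^esub>s\<in>?A. f s \<odot>\<^bsub>M\<^esub> b s \<oplus>\<^bsub>M\<^esub> g s \<odot>\<^bsub>M\<^esub> b s)"
      by (rule M.finsum_cong') (use A in \<open>auto simp: free_module_simps(3) smult_l_distr fR[OF f] fR[OF g] bM\<close>)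
    also have "\<dots> = (\<Oplus>\<^bsub>M\<^esub>s\<in>?A. f s \<odot>\<^bsub>M\<^esub> b s) \<oplus>\<^bsub>M\<^esub> (\<Oplus>\<^bsub>M\<^esub>s\<in>?A. g s \<odot>\<^bsub>M\<^esub> b s)"
      by (rule M.finsum_addf) (auto simp: fR[OF f] fR[OF g] bM)
    also have "\<dots> = free_lift R S M b f \<oplus>\<^bsub>M\<^esub> free_lift R S M b g"
      using free_lift_superset[OF f b A(1) _ A(2)] free_lift_superset[OF g b A(1) _ A(2)] by auto
    finally show "free_lift R S M b (f \<oplus>\<^bsub>free_module R S\<^esub> g)
        = free_lift R S M b f \<oplus>\<^bsub>M\<^esub> free_lift R S M b g" .
  }
  fix r assume r: "r \<in> carrier R"
  let ?A = "{s \<in> S. f s \<noteq> \<zero>}"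
  have A: "finite ?A" "?A \<subseteq> S" using f fin by auto
  have "free_lift R S M b (r \<odot>\<^bsub>free_module R S\<^esub> f)
      = (\<Oplus>\<^bsub>M\<^esub>s\<in>?A. (r \<odot>\<^bsub>free_module R S\<^esub> f) s \<odot>\<^bsub>M\<^esub> b s)"
    by (rule free_lift_superset[OF F.smult_closed[OF r f] b A(1) _ A(2)])
       (use r in \<open>auto simp: free_module_simps\<close>)
  also have "\<dots> = (\<Oplus>\<^bsub>M\<^esub>s\<in>?A. r \<odot>\<^bsub>M\<^esub> (f s \<odot>\<^bsub>M\<^esub> b s))"
    by (rule M.finsum_cong') (use A r in \<open>auto simp: free_module_simps(4) smult_assoc1 fR[OF f] bM\<close>)
  also have "\<dots> = r \<odot>\<^bsub>M\<^esub> (\<Oplus>\<^bsub>M\<^esub>s\<in>?A. f s \<odot>\<^bsub>M\<^esub> b s)"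
    by (rule finsum_smult_ldistr[symmetric, OF A(1) r]) (auto simp: fR[OF f] bM)
  also have "\<dots> = r \<odot>\<^bsub>M\<^esub> free_lift R S M b f" using f by (simp add: free_lift_def)
  finally show "free_lift R S M b (r \<odot>\<^bsub>free_module R S\<^esub> f) = r \<odot>\<^bsub>M\<^esub> free_lift R S M b f" .
qed

lemma free_lift_gen:
  assumes "b \<in> S \<rightarrow> carrier M" "s \<in> S"
  shows "free_lift R S M b (free_gen R S s) = b s"
proof -
  have bs: "b s \<in> carrier M" using assms by blast
  \<comment> \<open>The support of a generator is \<open>{s}\<close>, except over the zero ring,
    where it is empty; \<open>{s}\<close> as a superset covers both cases.\<close>
  have "free_lift R S M b (free_gen R S s) = (\<Oplus>\<^bsub>M\<^esub>t\<in>{s}. free_gen R S s t \<odot>\<^bsub>M\<^esub> b t)"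
    by (rule free_lift_superset[OF free_gen_closed[OF assms(2)] assms(1)])
       (use assms(2) in \<open>auto simp: free_gen_def\<close>)
  also have "\<dots> = b s" using assms(2) bs by (simp add: free_gen_def)
  finally show ?thesis .
qed

end

section \<open>Quotients and the universal property of the tensor product\<close>

lemma quotient_module_simps:
  "carrier (quotient_module M H) = a_rcosets\<^bsub>M\<^esub> H"
  "C \<oplus>\<^bsub>quotient_module M H\<^esub> D = C <+>\<^bsub>M\<^esub> D"
  "r \<odot>\<^bsub>quotient_module M H\<^esub> C = (\<Union>x\<in>C. H +>\<^bsub>M\<^esub> (r \<odot>\<^bsub>M\<^esub> x))"
  by (simp_all add: quotient_module_def)

context module
begin

lemma submodule_abelian_subgroup: "submodule H R M \<Longrightarrow> abelian_subgroup H M"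
  by (intro abelian_subgroupI3 additive_subgroup.intro)
     (auto simp: submodule_def M.abelian_group_axioms)

lemma quotient_module_carrier:
  "carrier (quotient_module M H) = {H +>\<^bsub>M\<^esub> x | x. x \<in> carrier M}"
  by (auto simp: quotient_module_simps A_RCOSETS_def')

lemma quotient_module_add:
  assumes "submodule H R M" "x \<in> carrier M" "y \<in> carrier M"
  shows "(H +>\<^bsub>M\<^esub> x) \<oplus>\<^bsub>quotient_module M H\<^esub> (H +>\<^bsub>M\<^esub> y) = H +>\<^bsub>M\<^esub> (x \<oplus>\<^bsub>M\<^esub> y)"
  using abelian_subgroup.a_rcos_sum[OF submodule_abelian_subgroup[OF assms(1)] assms(2,3)]
  by (simp add: quotient_module_simps)

lemma coset_memE:
  assumes "submodule H R M" "y \<in> H +>\<^bsub>M\<^esub> x"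
  obtains h where "h \<in> H" "y = h \<oplus>\<^bsub>M\<^esub> x"
  using assms by (auto simp: a_r_coset_def')

text \<open>The scalar multiple of a coset is a union over all its representatives. Two
  representatives differ by some h in H and \<open>r h\<close> stays in H, so all cosets in this
  nonempty union coincide.\<close>

lemma quotient_module_smult:
  assumes H: "submodule H R M" and r: "r \<in> carrier R" and x: "x \<in> carrier M"
  shows "r \<odot>\<^bsub>quotient_module M H\<^esub> (H +>\<^bsub>M\<^esub> x) = H +>\<^bsub>M\<^esub> (r \<odot>\<^bsub>M\<^esub> x)"
proof -
  interpret H: abelian_subgroup H M by (rule submodule_abelian_subgroup[OF H])
  have "H +>\<^bsub>M\<^esub> (r \<odot>\<^bsub>M\<^esub> y) = H +>\<^bsub>M\<^esub> (r \<odot>\<^bsub>M\<^esub> x)" if y: "y \<in> H +>\<^bsub>M\<^esub> x" for y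
  proof -
    obtain h where h: "h \<in> H" "y = h \<oplus>\<^bsub>M\<^esub> x" using coset_memE[OF H y] .
    then have hM: "h \<in> carrier M" using submoduleE(1)[OF H] by blast
    have "r \<odot>\<^bsub>M\<^esub> y = r \<odot>\<^bsub>M\<^esub> h \<oplus>\<^bsub>M\<^esub> r \<odot>\<^bsub>M\<^esub> x" using h hM r x by (simp add: smult_r_distr)
    moreover have "r \<odot>\<^bsub>M\<^esub> h \<in> H" using submoduleE(4)[OF H r h(1)] .
    ultimately have "r \<odot>\<^bsub>M\<^esub> y \<in> H +>\<^bsub>M\<^esub> (r \<odot>\<^bsub>M\<^esub> x)" by (auto simp: a_r_coset_def')
    then show ?thesis using H.a_repr_independence' r x by simp
  qed
  moreover have "H +>\<^bsub>M\<^esub> x \<noteq> {}" using H.a_rcos_self[OF x] by blast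
  ultimately show ?thesis unfolding quotient_module_simps by (intro SUP_eq_const)
qed

text \<open>The value on a coset is taken at an arbitrarily chosen representative; another choice
  changes it by an element of H, which L sends to zero.\<close>

lemma quotient_lift_exists:
  assumes H: "submodule H R M" and P: "module R P" and L: "L \<in> mod_hom R M P"
    and ker: "\<And>h. h \<in> H \<Longrightarrow> L h = \<zero>\<^bsub>P\<^esub>"
  obtains g where "g \<in> mod_hom R (quotient_module M H) P"
    "\<And>x. x \<in> carrier M \<Longrightarrow> g (H +>\<^bsub>M\<^esub> x) = L x"
proof -
  interpret H: abelian_subgroup H M by (rule submodule_abelian_subgroup[OF H])
  interpret P: module R P by (rule P)
  define g where "g = (\<lambda>C\<in>carrier (quotient_module M H). L (SOME x. x \<in> C))"
  have g: "g (H +>\<^bsub>M\<^esub> x) = L x" if x: "x \<in> carrier M" for x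
  proof -
    have "(SOME y. y \<in> H +>\<^bsub>M\<^esub> x) \<in> H +>\<^bsub>M\<^esub> x"
      using H.a_rcos_self[OF x] by (rule someI)
    then obtain h where h: "h \<in> H" "(SOME y. y \<in> H +>\<^bsub>M\<^esub> x) = h \<oplus>\<^bsub>M\<^esub> x"
      using coset_memE[OF H] by metis
    have "h \<in> carrier M" using h submoduleE(1)[OF H] by blast
    then have "L (h \<oplus>\<^bsub>M\<^esub> x) = L x"
      using x ker[OF h(1)] by (simp add: mod_hom_add[OF L] mod_hom_closed[OF L])
    moreover have "H +>\<^bsub>M\<^esub> x \<in> carrier (quotient_module M H)"
      using x by (auto simp: quotient_module_carrier)
    ultimately show ?thesis using h by (simp add: g_def)
  qed
  have "g \<in> mod_hom R (quotient_module M H) P"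
  proof (rule mod_homI)
    have "g C \<in> carrier P" if "C \<in> carrier (quotient_module M H)" for C
      using that g mod_hom_closed[OF L] by (auto simp: quotient_module_carrier)
    then show "g \<in> carrier (quotient_module M H) \<rightarrow>\<^sub>E carrier P" by (auto simp: g_def)
  next
    fix C D assume "C \<in> carrier (quotient_module M H)" "D \<in> carrier (quotient_module M H)"
    then obtain x y where "x \<in> carrier M" "C = H +>\<^bsub>M\<^esub> x" "y \<in> carrier M" "D = H +>\<^bsub>M\<^esub> y"
      by (auto simp: quotient_module_carrier)
    then show "g (C \<oplus>\<^bsub>quotient_module M H\<^esub> D) = g C \<oplus>\<^bsub>P\<^esub> g D"
      by (simp add: quotient_module_add[OF H] g mod_hom_add[OF L])
  next
    fix r C assume "r \<in> carrier R" "C \<in> carrier (quotient_module M H)"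
    moreover then obtain x where "x \<in> carrier M" "C = H +>\<^bsub>M\<^esub> x"
      by (auto simp: quotient_module_carrier)
    ultimately show "g (r \<odot>\<^bsub>quotient_module M H\<^esub> C) = r \<odot>\<^bsub>P\<^esub> g C"
      by (simp add: quotient_module_smult[OF H] g mod_hom_smult[OF L])
  qed
  then show thesis using g that by blast
qed

end

section \<open>Universal property of the concrete tensor product\<close>

lemma (in cring) tensor_relations_closed:
  assumes "module R M" "module R N"
  shows "tensor_relations R M N \<subseteq> carrier (free_module R (carrier M \<times> carrier N))"
proof -
  interpret M: module R M by fact
  interpret N: module R N by fact
  interpret F: module R "free_module R (carrier M \<times> carrier N)" by (rule free_module_module)
  show ?thesis
    by (auto simp: tensor_relations_def Let_def intro!: F.M.minus_closed free_gen_closed)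
qed

lemma (in cring) tensor_null_submodule:
  assumes "module R M" "module R N"
  shows "submodule (tensor_null R M N) R (free_module R (carrier M \<times> carrier N))"
  unfolding tensor_null_def
  by (rule mod_span_submodule[OF free_module_module tensor_relations_closed[OF assms]])

text \<open>Extend \<open>\<beta>\<close> linearly to the free module on pairs. Bilinearity says
  exactly that the defining relations go to zero, so the kernel contains their span and the
  extension descends to the quotient.\<close>

lemma (in cring) tensor_lift_exists:
  assumes M: "module R M" and N: "module R N" and P: "module R P"
    and closed: "\<And>x y. \<lbrakk>x \<in> carrier M; y \<in> carrier N\<rbrakk> \<Longrightarrow> \<beta> x y \<in> carrier P"
    and add1: "\<And>x x' y. \<lbrakk>x \<in> carrier M; x' \<in> carrier M; y \<in> carrier N\<rbrakk>
      \<Longrightarrow> \<beta> (x \<oplus>\<^bsub>M\<^esub> x') y = \<beta> x y \<oplus>\<^bsub>P\<^esub> \<beta> x' y"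
    and add2: "\<And>x y y'. \<lbrakk>x \<in> carrier M; y \<in> carrier N; y' \<in> carrier N\<rbrakk>
      \<Longrightarrow> \<beta> x (y \<oplus>\<^bsub>N\<^esub> y') = \<beta> x y \<oplus>\<^bsub>P\<^esub> \<beta> x y'"
    and smult1: "\<And>r x y. \<lbrakk>r \<in> carrier R; x \<in> carrier M; y \<in> carrier N\<rbrakk>
      \<Longrightarrow> \<beta> (r \<odot>\<^bsub>M\<^esub> x) y = r \<odot>\<^bsub>P\<^esub> \<beta> x y"
    and smult2: "\<And>r x y. \<lbrakk>r \<in> carrier R; x \<in> carrier M; y \<in> carrier N\<rbrakk>
      \<Longrightarrow> \<beta> x (r \<odot>\<^bsub>N\<^esub> y) = r \<odot>\<^bsub>P\<^esub> \<beta> x y"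
  shows "\<exists>g\<in>mod_hom R (tensor_module R M N) P.
    \<forall>x\<in>carrier M. \<forall>y\<in>carrier N. g (pure_tensor R M N x y) = \<beta> x y"
proof -
  interpret M: module R M by fact
  interpret N: module R N by fact
  interpret P: module R P by fact
  let ?S = "carrier M \<times> carrier N"
  let ?F = "free_module R ?S"
  interpret F: module R ?F by (rule free_module_module)
  define L where "L = free_lift R ?S P (case_prod \<beta>)"
  have b: "case_prod \<beta> \<in> ?S \<rightarrow> carrier P" using closed by auto
  have L: "L \<in> mod_hom R ?F P" unfolding L_def by (rule P.free_lift_hom[OF b])
  have gen: "L (free_gen R ?S (x, y)) = \<beta> x y" if "x \<in> carrier M" "y \<in> carrier N" for x y
    unfolding L_def using P.free_lift_gen[OF b, of "(x, y)"] that by simp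
  let ?K = "{f \<in> carrier ?F. L f = \<zero>\<^bsub>P\<^esub>}"
  \<comment> \<open>All four kinds of relation are differences of two elements, so each is handled
    by comparing two values of L.\<close>
  have minus: "f \<ominus>\<^bsub>?F\<^esub> g \<in> ?K" if "f \<in> carrier ?F" "g \<in> carrier ?F" "L f = L g" for f g
    using that mod_hom_minus[OF F.module_axioms P L that(1,2)] mod_hom_closed[OF L that(2)]
    by (simp add: P.M.r_neg P.M.minus_eq)
  have e: "free_gen R ?S (x, y) \<in> carrier ?F" if "x \<in> carrier M" "y \<in> carrier N" for x y
    using that by (intro free_gen_closed) auto
  have "tensor_null R M N \<subseteq> ?K"
    unfolding tensor_null_def
  proof (rule mod_span_minimal[OF mod_hom_kernel_submodule[OF F.module_axioms P L]])
    show "tensor_relations R M N \<subseteq> ?K"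
      unfolding tensor_relations_def Let_def
      by (intro subsetI, elim UnE CollectE exE conjE; hypsubst; rule minus)
         (simp_all add: e gen mod_hom_add[OF L] mod_hom_smult[OF L] add1 add2 smult1 smult2)
  qed
  then obtain g where g: "g \<in> mod_hom R (quotient_module ?F (tensor_null R M N)) P"
    "\<And>f. f \<in> carrier ?F \<Longrightarrow> g (tensor_null R M N +>\<^bsub>?F\<^esub> f) = L f"
    using F.quotient_lift_exists[OF tensor_null_submodule[OF M N] P L] by blast
  then show ?thesis
    unfolding tensor_module_def pure_tensor_def by (intro bexI[of _ g]) (auto simp: e gen)
qed

text \<open>Induction over sums of multiples of pure tensors. The base case is phrased with
  \<open>\<zero>\<close> times an element because a homomorphism can be evaluated there by
  \<open>mod_hom_smult\<close> alone, with no appeal to the module axioms of the quotient.\<close>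

lemma (in cring) tensor_module_induct [consumes 3, case_names zero add]:
  assumes M: "module R M" and N: "module R N" and C: "C \<in> carrier (tensor_module R M N)"
    and zero: "\<And>D. D \<in> carrier (tensor_module R M N) \<Longrightarrow> Q (\<zero> \<odot>\<^bsub>tensor_module R M N\<^esub> D)"
    and add: "\<And>D r x y. \<lbrakk>D \<in> carrier (tensor_module R M N); r \<in> carrier R; x \<in> carrier M;
        y \<in> carrier N; Q D; pure_tensor R M N x y \<in> carrier (tensor_module R M N);
        r \<odot>\<^bsub>tensor_module R M N\<^esub> pure_tensor R M N x y \<in> carrier (tensor_module R M N)\<rbrakk> \<Longrightarrow>
      Q (D \<oplus>\<^bsub>tensor_module R M N\<^esub> r \<odot>\<^bsub>tensor_module R M N\<^esub> pure_tensor R M N x y)"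
  shows "Q C"
proof -
  let ?S = "carrier M \<times> carrier N"
  let ?F = "free_module R ?S"
  let ?H = "tensor_null R M N"
  interpret F: module R ?F by (rule free_module_module)
  note H = tensor_null_submodule[OF M N]
  have in_T: "?H +>\<^bsub>?F\<^esub> f \<in> carrier (tensor_module R M N)" if "f \<in> carrier ?F" for f
    using that by (auto simp: tensor_module_def F.quotient_module_carrier)
  have "Q (?H +>\<^bsub>?F\<^esub> f)" if "f \<in> carrier ?F" for f
    using that
  proof (induction f rule: free_module_induct)
    case zero
    have "\<zero> \<odot>\<^bsub>tensor_module R M N\<^esub> (?H +>\<^bsub>?F\<^esub> \<zero>\<^bsub>?F\<^esub>) = ?H +>\<^bsub>?F\<^esub> \<zero>\<^bsub>?F\<^esub>"
      unfolding tensor_module_def by (simp add: F.quotient_module_smult[OF H])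
    then show ?case using assms(4)[OF in_T[OF F.M.zero_closed]] by simp
  next
    case (add f r s)
    obtain x y where s: "s = (x, y)" "x \<in> carrier M" "y \<in> carrier N" using add by auto
    have e: "free_gen R ?S s \<in> carrier ?F" using add by (simp add: free_gen_closed)
    have sm: "r \<odot>\<^bsub>tensor_module R M N\<^esub> pure_tensor R M N x y = ?H +>\<^bsub>?F\<^esub> (r \<odot>\<^bsub>?F\<^esub> free_gen R ?S s)"
      unfolding tensor_module_def pure_tensor_def using add e s
      by (simp add: F.quotient_module_smult[OF H])
    have "(?H +>\<^bsub>?F\<^esub> f) \<oplus>\<^bsub>tensor_module R M N\<^esub> r \<odot>\<^bsub>tensor_module R M N\<^esub> pure_tensor R M N x y
        = ?H +>\<^bsub>?F\<^esub> (f \<oplus>\<^bsub>?F\<^esub> r \<odot>\<^bsub>?F\<^esub> free_gen R ?S s)"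
      unfolding sm unfolding tensor_module_def using add e
      by (simp add: F.quotient_module_add[OF H])
    moreover have "pure_tensor R M N x y \<in> carrier (tensor_module R M N)"
      using in_T[OF e] s by (simp add: pure_tensor_def)
    moreover have "r \<odot>\<^bsub>tensor_module R M N\<^esub> pure_tensor R M N x y \<in> carrier (tensor_module R M N)"
      unfolding sm using in_T add e by simp
    ultimately show ?case using assms(5)[of "?H +>\<^bsub>?F\<^esub> f" r x y] in_T add s by simp
  qed
  then show ?thesis using C by (auto simp: tensor_module_def F.quotient_module_carrier)
qed

lemma (in cring) pure_tensor_closed:
  assumes "x \<in> carrier M" "y \<in> carrier N"
  shows "pure_tensor R M N x y \<in> carrier (tensor_module R M N)"
proof -
  interpret F: module R "free_module R (carrier M \<times> carrier N)" by (rule free_module_module)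
  have "free_gen R (carrier M \<times> carrier N) (x, y) \<in> carrier (free_module R (carrier M \<times> carrier N))"
    using assms by (intro free_gen_closed) auto
  then show ?thesis by (auto simp: pure_tensor_def tensor_module_def F.quotient_module_carrier)
qed

lemma (in cring) tensor_module_closed:
  assumes "module R M" "module R N" "C \<in> carrier (tensor_module R M N)"
  shows "D \<in> carrier (tensor_module R M N) \<Longrightarrow> C \<oplus>\<^bsub>tensor_module R M N\<^esub> D \<in> carrier (tensor_module R M N)"
    and "r \<in> carrier R \<Longrightarrow> r \<odot>\<^bsub>tensor_module R M N\<^esub> C \<in> carrier (tensor_module R M N)"
proof -
  interpret F: module R "free_module R (carrier M \<times> carrier N)" by (rule free_module_module)
  note H = tensor_null_submodule[OF assms(1,2)]
  show "C \<oplus>\<^bsub>tensor_module R M N\<^esub> D \<in> carrier (tensor_module R M N)"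
    if "D \<in> carrier (tensor_module R M N)"
    using that assms(3) F.quotient_module_add[OF H] F.M.a_closed
    unfolding tensor_module_def F.quotient_module_carrier by fastforce
  show "r \<odot>\<^bsub>tensor_module R M N\<^esub> C \<in> carrier (tensor_module R M N)" if "r \<in> carrier R"
    using that assms(3) F.quotient_module_smult[OF H] F.smult_closed
    unfolding tensor_module_def F.quotient_module_carrier by fastforce
qed

text \<open>The uniqueness half of the universal property: pure tensors generate.\<close>

lemma (in cring) tensor_hom_eqI:
  assumes M: "module R M" and N: "module R N" and P: "module R P"
    and g: "g \<in> mod_hom R (tensor_module R M N) P" and h: "h \<in> mod_hom R (tensor_module R M N) P"
    and eq: "\<And>x y. \<lbrakk>x \<in> carrier M; y \<in> carrier N\<rbrakk> \<Longrightarrow>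
      g (pure_tensor R M N x y) = h (pure_tensor R M N x y)"
  shows "g = h"
proof (rule mod_hom_eqI[OF g h])
  interpret P: module R P by fact
  fix C assume "C \<in> carrier (tensor_module R M N)"
  with M N show "g C = h C"
  proof (induction C rule: tensor_module_induct)
    case (zero D)
    then show ?case using mod_hom_smult[OF g] mod_hom_smult[OF h] mod_hom_closed[OF g] mod_hom_closed[OF h]
      by simp
  next
    case (add D r x y)
    then show ?case
      by (simp add: mod_hom_add[OF g] mod_hom_add[OF h] mod_hom_smult[OF g] mod_hom_smult[OF h] eq)
  qed
qed

text \<open>Discharges the \<open>THE\<close> in \<open>tensor_lift\<close>: any homomorphism with
  the prescribed values on pure tensors is the lift.\<close>

lemma (in cring) tensor_lift_unique:
  assumes "module R M" "module R N" "module R P"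
    and g: "g \<in> mod_hom R (tensor_module R M N) P"
    and \<beta>: "\<And>x y. \<lbrakk>x \<in> carrier M; y \<in> carrier N\<rbrakk> \<Longrightarrow> g (pure_tensor R M N x y) = \<beta> x y"
  shows "tensor_lift R M N P \<beta> = g"
  unfolding tensor_lift_def
proof (rule the_equality)
  fix h assume "h \<in> mod_hom R (tensor_module R M N) P \<and>
    (\<forall>x\<in>carrier M. \<forall>y\<in>carrier N. h (pure_tensor R M N x y) = \<beta> x y)"
  then show "h = g" using \<beta> by (intro tensor_hom_eqI[OF assms(1-3) _ g]) auto
qed (use g \<beta> in auto)

section \<open>Duals and the trace ideal\<close>

lemma Hom_module_simps [simp]:
  "carrier (Hom_module R M N) = mod_hom R M N"
  "\<zero>\<^bsub>Hom_module R M N\<^esub> = (\<lambda>x\<in>carrier M. \<zero>\<^bsub>N\<^esub>)"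
  "f \<oplus>\<^bsub>Hom_module R M N\<^esub> g = (\<lambda>x\<in>carrier M. f x \<oplus>\<^bsub>N\<^esub> g x)"
  "r \<odot>\<^bsub>Hom_module R M N\<^esub> f = (\<lambda>x\<in>carrier M. r \<odot>\<^bsub>N\<^esub> f x)"
  by (simp_all add: Hom_module_def)

lemma Hom_module_module:
  assumes M: "module R M" and N: "module R N"
  shows "module R (Hom_module R M N)"
proof -
  interpret M: module R M by fact
  interpret N: module R N by fact
  let ?H = "Hom_module R M N"
  have app: "(f \<oplus>\<^bsub>?H\<^esub> g) x = f x \<oplus>\<^bsub>N\<^esub> g x" "(r \<odot>\<^bsub>?H\<^esub> f) x = r \<odot>\<^bsub>N\<^esub> f x" "\<zero>\<^bsub>?H\<^esub> x = \<zero>\<^bsub>N\<^esub>"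
    if "x \<in> carrier M" for f g r x using that by simp_all
  have val: "f x \<in> carrier N" if "f \<in> carrier ?H" "x \<in> carrier M" for f x
    using that by (auto intro: mod_hom_closed)
  have zero: "\<zero>\<^bsub>?H\<^esub> \<in> carrier ?H" by (auto intro!: mod_homI)
  have add: "f \<oplus>\<^bsub>?H\<^esub> g \<in> carrier ?H" if "f \<in> carrier ?H" "g \<in> carrier ?H" for f g
    unfolding Hom_module_simps(1)
    by (rule mod_homI)
       (use that in \<open>auto simp: mod_hom_add mod_hom_smult mod_hom_closed N.M.a_ac N.smult_r_distr\<close>)
  \<comment> \<open>Commutativity of R enters here: the multiple of f by r is again linear because r
    and s may be exchanged in \<open>r (s f(x))\<close>.\<close>
  have smult: "r \<odot>\<^bsub>?H\<^esub> f \<in> carrier ?H" if r: "r \<in> carrier R" and f: "f \<in> carrier ?H" for r f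
    unfolding Hom_module_simps(1)
  proof (rule mod_homI)
    fix s x assume "s \<in> carrier R" "x \<in> carrier M"
    then show "(r \<odot>\<^bsub>?H\<^esub> f) (s \<odot>\<^bsub>M\<^esub> x) = s \<odot>\<^bsub>N\<^esub> (r \<odot>\<^bsub>?H\<^esub> f) x"
      using r f by (simp add: mod_hom_smult mod_hom_closed N.smult_assoc1[symmetric] M.R.m_comm)
  qed (use r f in \<open>auto simp: mod_hom_add mod_hom_closed N.smult_r_distr\<close>)
  have ext: "f = g" if "f \<in> carrier ?H" "g \<in> carrier ?H" "\<And>x. x \<in> carrier M \<Longrightarrow> f x = g x" for f g
    using that by (auto intro: mod_hom_eqI)
  note closed = zero add smult
  have "abelian_group ?H"
  proof (rule abelian_groupI)
    fix f assume f: "f \<in> carrier ?H"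
    have c: "\<ominus>\<^bsub>R\<^esub> \<one>\<^bsub>R\<^esub> \<odot>\<^bsub>?H\<^esub> f \<in> carrier ?H" by (rule smult) (use f in simp_all)
    moreover have "(\<ominus>\<^bsub>R\<^esub> \<one>\<^bsub>R\<^esub> \<odot>\<^bsub>?H\<^esub> f) \<oplus>\<^bsub>?H\<^esub> f = \<zero>\<^bsub>?H\<^esub>"
      by (rule ext[OF add[OF c f] zero])
         (simp add: app val[OF f] N.smult_l_minus N.M.l_neg del: Hom_module_simps)
    ultimately show "\<exists>g\<in>carrier ?H. g \<oplus>\<^bsub>?H\<^esub> f = \<zero>\<^bsub>?H\<^esub>" by blast
  qed (simp_all add: closed del: Hom_module_simps,
       (rule ext; simp add: closed app val N.M.a_ac del: Hom_module_simps)+)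
  then show ?thesis
    by (intro moduleI)
       (simp_all add: M.R.is_cring closed del: Hom_module_simps,
        (rule ext; simp add: closed app val N.smult_l_distr N.smult_r_distr N.smult_assoc1
           del: Hom_module_simps)+)
qed

lemma dual_module_simps [simp]:
  "carrier (dual_module R M) = mod_hom R M (ring_module R)"
  "\<zero>\<^bsub>dual_module R M\<^esub> = (\<lambda>x\<in>carrier M. \<zero>\<^bsub>R\<^esub>)"
  "\<alpha> \<oplus>\<^bsub>dual_module R M\<^esub> \<beta> = (\<lambda>x\<in>carrier M. \<alpha> x \<oplus>\<^bsub>R\<^esub> \<beta> x)"
  "r \<odot>\<^bsub>dual_module R M\<^esub> \<alpha> = (\<lambda>x\<in>carrier M. r \<otimes>\<^bsub>R\<^esub> \<alpha> x)"
  by (simp_all add: dual_module_def)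

lemma trace_module_simps [simp]:
  "carrier (trace_module R M) = trace_ideal R M" "\<zero>\<^bsub>trace_module R M\<^esub> = \<zero>\<^bsub>R\<^esub>"
  "x \<oplus>\<^bsub>trace_module R M\<^esub> y = x \<oplus>\<^bsub>R\<^esub> y" "r \<odot>\<^bsub>trace_module R M\<^esub> x = r \<otimes>\<^bsub>R\<^esub> x"
  by (simp_all add: trace_module_def ring_module_def)

lemma End_ring_simps [simp]:
  "carrier (End_ring R M) = mod_hom R M M"
  "f \<otimes>\<^bsub>End_ring R M\<^esub> g = compose (carrier M) f g"
  by (simp_all add: End_ring_def)

lemma mod_hom_compose:
  assumes "f \<in> mod_hom R N P" "g \<in> mod_hom R M N" "module R M"
  shows "compose (carrier M) f g \<in> mod_hom R M P"
proof -
  interpret module R M by fact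
  show ?thesis
    by (rule mod_homI)
       (use assms in \<open>auto simp: compose_def mod_hom_closed mod_hom_add mod_hom_smult\<close>)
qed

section \<open>Functionals, closure properties of the trace ideal, and its endomorphisms\<close>

context module
begin

lemma dual_module_module: "module R (dual_module R M)"
  unfolding dual_module_def by (rule Hom_module_module[OF module_axioms ring_module_module])

lemma dual_closed: "\<lbrakk>\<alpha> \<in> mod_hom R M (ring_module R); m \<in> carrier M\<rbrakk> \<Longrightarrow> \<alpha> m \<in> carrier R"
  using mod_hom_closed by fastforce

lemma dual_add:
  "\<lbrakk>\<alpha> \<in> mod_hom R M (ring_module R); m \<in> carrier M; n \<in> carrier M\<rbrakk> \<Longrightarrow>
    \<alpha> (m \<oplus>\<^bsub>M\<^esub> n) = \<alpha> m \<oplus> \<alpha> n"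
  using mod_hom_add by fastforce

lemma dual_smult:
  "\<lbrakk>\<alpha> \<in> mod_hom R M (ring_module R); r \<in> carrier R; m \<in> carrier M\<rbrakk> \<Longrightarrow>
    \<alpha> (r \<odot>\<^bsub>M\<^esub> m) = r \<otimes> \<alpha> m"
  using mod_hom_smult by fastforce

lemma dual_zero: "\<alpha> \<in> mod_hom R M (ring_module R) \<Longrightarrow> \<alpha> \<zero>\<^bsub>M\<^esub> = \<zero>"
  using mod_hom_zero[OF module_axioms ring_module_module] by fastforce

lemma trace_ideal_memI:
  assumes "\<alpha> \<in> mod_hom R M (ring_module R)" "m \<in> carrier M"
  shows "\<alpha> m \<in> trace_ideal R M"
proof -
  define t where "t = (\<lambda>\<beta> :: 'c \<Rightarrow> 'a. \<beta> m)"
  have "finsum R t {\<alpha>} = t \<alpha> \<oplus> finsum R t {}"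
    by (rule R.finsum_insert) (use dual_closed[OF assms] in \<open>simp_all add: t_def\<close>)
  also have "\<dots> = \<alpha> m" using dual_closed[OF assms] by (simp add: t_def)
  finally have "\<alpha> m = (\<Oplus>\<beta>\<in>{\<alpha>}. t \<beta>) \<and> finite {\<alpha>} \<and> {\<alpha>} \<subseteq> carrier (dual_module R M) \<and>
      (\<forall>\<beta>\<in>{\<alpha>}. t \<beta> \<in> \<beta> ` carrier M)"
    using assms by (simp add: t_def)
  then show ?thesis unfolding trace_ideal_def by (intro CollectI exI)
qed

text \<open>An induction principle for the trace ideal. Closure of J under addition is enough, since
  multiples of a value \<open>\<alpha> m\<close> are again values of \<open>\<alpha>\<close>; J may
  thus be any additive property, such as agreement of two endomorphisms.\<close>

lemma trace_ideal_minimal: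
  assumes zero: "\<zero> \<in> J" and add: "\<And>x y. \<lbrakk>x \<in> J; y \<in> J\<rbrakk> \<Longrightarrow> x \<oplus> y \<in> J"
    and mem: "\<And>\<alpha> m. \<lbrakk>\<alpha> \<in> mod_hom R M (ring_module R); m \<in> carrier M\<rbrakk> \<Longrightarrow> \<alpha> m \<in> J"
  shows "trace_ideal R M \<subseteq> J"
proof
  fix x assume "x \<in> trace_ideal R M"
  then obtain F t where F: "finite F" "F \<subseteq> mod_hom R M (ring_module R)" "\<forall>\<alpha>\<in>F. t \<alpha> \<in> \<alpha> ` carrier M"
    and x: "x = (\<Oplus>\<alpha>\<in>F. t \<alpha>)" by (auto simp: trace_ideal_def)
  from F have "(\<Oplus>\<alpha>\<in>F. t \<alpha>) \<in> J"
  proof (induction F rule: finite_induct)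
    case empty
    then show ?case using zero by simp
  next
    case (insert \<alpha> F)
    have "t \<beta> \<in> carrier R" if \<beta>: "\<beta> \<in> insert \<alpha> F" for \<beta>
    proof -
      obtain m where "m \<in> carrier M" "t \<beta> = \<beta> m" using insert.prems(2) \<beta> by blast
      moreover have "\<beta> \<in> mod_hom R M (ring_module R)" using insert.prems(1) \<beta> by (rule subsetD)
      ultimately show ?thesis by (simp add: dual_closed)
    qed
    then have "(\<Oplus>\<beta>\<in>insert \<alpha> F. t \<beta>) = t \<alpha> \<oplus> (\<Oplus>\<beta>\<in>F. t \<beta>)"
      using insert.hyps by (intro R.finsum_insert) auto
    moreover have "t \<alpha> \<in> J"
    proof -
      obtain m where "m \<in> carrier M" "t \<alpha> = \<alpha> m" using insert.prems(2) by blast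
      then show ?thesis using mem[of \<alpha> m] insert.prems(1) by simp
    qed
    moreover have "(\<Oplus>\<beta>\<in>F. t \<beta>) \<in> J" using insert.IH insert.prems by simp
    ultimately show ?case using add by simp
  qed
  then show "x \<in> J" using x by simp
qed

lemma trace_ideal_closed: "trace_ideal R M \<subseteq> carrier R"
  by (rule trace_ideal_minimal) (auto intro: dual_closed)

lemma trace_ideal_carr: "t \<in> trace_ideal R M \<Longrightarrow> t \<in> carrier R"
  using trace_ideal_closed by blast

lemma trace_ideal_zero: "\<zero> \<in> trace_ideal R M"
proof -
  have "(\<lambda>x\<in>carrier M. \<zero>) \<in> mod_hom R M (ring_module R)" by (auto intro!: mod_homI)
  from trace_ideal_memI[OF this M.zero_closed] show ?thesis by simp
qed

text \<open>The defining sums have one summand per functional, so two of them cannot simply be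
  concatenated. Both families are extended by zero to the union of their index sets and added
  termwise; \<open>\<alpha> m \<oplus> \<alpha> n = \<alpha> (m + n)\<close> keeps each term in the
  image of its functional.\<close>

lemma trace_ideal_add:
  assumes "x \<in> trace_ideal R M" "y \<in> trace_ideal R M"
  shows "x \<oplus> y \<in> trace_ideal R M"
proof -
  let ?D = "mod_hom R M (ring_module R)"
  obtain F t where F: "finite F" "F \<subseteq> ?D" "\<forall>\<alpha>\<in>F. t \<alpha> \<in> \<alpha> ` carrier M" and x: "x = (\<Oplus>\<alpha>\<in>F. t \<alpha>)"
    using assms(1) by (auto simp: trace_ideal_def)
  obtain G u where G: "finite G" "G \<subseteq> ?D" "\<forall>\<alpha>\<in>G. u \<alpha> \<in> \<alpha> ` carrier M" and y: "y = (\<Oplus>\<alpha>\<in>G. u \<alpha>)"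
    using assms(2) by (auto simp: trace_ideal_def)
  define t' where "t' = (\<lambda>\<alpha>. if \<alpha> \<in> F then t \<alpha> else \<zero>)"
  define u' where "u' = (\<lambda>\<alpha>. if \<alpha> \<in> G then u \<alpha> else \<zero>)"
  have img_zero: "\<zero> \<in> \<alpha> ` carrier M" if "\<alpha> \<in> ?D" for \<alpha>
    using dual_zero[OF that] by (intro image_eqI[of _ _ "\<zero>\<^bsub>M\<^esub>"]) auto
  have t': "t' \<alpha> \<in> \<alpha> ` carrier M" and u': "u' \<alpha> \<in> \<alpha> ` carrier M" if "\<alpha> \<in> F \<union> G" for \<alpha>
    using that F G img_zero unfolding t'_def u'_def by auto
  have img: "s \<in> carrier R" if s: "s \<in> \<alpha> ` carrier M" and \<alpha>: "\<alpha> \<in> F \<union> G" for s \<alpha>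
  proof -
    obtain m where "m \<in> carrier M" "s = \<alpha> m" using s by blast
    moreover have "\<alpha> \<in> ?D" using \<alpha> F(2) G(2) by blast
    ultimately show ?thesis by (simp add: dual_closed)
  qed
  have tu: "t' \<alpha> \<oplus> u' \<alpha> \<in> \<alpha> ` carrier M" if \<alpha>: "\<alpha> \<in> F \<union> G" for \<alpha>
  proof -
    obtain m n where "m \<in> carrier M" "n \<in> carrier M" "t' \<alpha> = \<alpha> m" "u' \<alpha> = \<alpha> n"
      using t'[OF \<alpha>] u'[OF \<alpha>] by blast
    moreover have "\<alpha> \<in> ?D" using \<alpha> F G by blast
    ultimately show ?thesis by (intro image_eqI[of _ _ "m \<oplus>\<^bsub>M\<^esub> n"]) (auto simp: dual_add)
  qed
  have tR: "t' \<in> F \<union> G \<rightarrow> carrier R" and uR: "u' \<in> F \<union> G \<rightarrow> carrier R"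
    using img[OF t'] img[OF u'] by simp_all
  have "x = (\<Oplus>\<alpha>\<in>F \<union> G. t' \<alpha>)"
    unfolding x by (rule R.add.finprod_mono_neutral_cong_left[OF _ _ _ _ tR])
      (use F(1) G(1) in \<open>auto simp: t'_def\<close>)
  moreover have "y = (\<Oplus>\<alpha>\<in>F \<union> G. u' \<alpha>)"
    unfolding y by (rule R.add.finprod_mono_neutral_cong_left[OF _ _ _ _ uR])
      (use F(1) G(1) in \<open>auto simp: u'_def\<close>)
  ultimately have "x \<oplus> y = (\<Oplus>\<alpha>\<in>F \<union> G. t' \<alpha> \<oplus> u' \<alpha>)"
    using R.finsum_addf[OF tR uR] by simp
  moreover define v where "v = (\<lambda>\<alpha>. t' \<alpha> \<oplus> u' \<alpha>)"
  ultimately have "x \<oplus> y = (\<Oplus>\<alpha>\<in>F \<union> G. v \<alpha>) \<and> finite (F \<union> G) \<and>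
      F \<union> G \<subseteq> carrier (dual_module R M) \<and> (\<forall>\<alpha>\<in>F \<union> G. v \<alpha> \<in> \<alpha> ` carrier M)"
    using F(1,2) G(1,2) tu by simp
  then show ?thesis unfolding trace_ideal_def by (intro CollectI exI)
qed

lemma trace_ideal_smult:
  assumes r: "r \<in> carrier R" and x: "x \<in> trace_ideal R M"
  shows "r \<otimes> x \<in> trace_ideal R M"
proof -
  have "trace_ideal R M \<subseteq> {x \<in> carrier R. r \<otimes> x \<in> trace_ideal R M}"
  proof (rule trace_ideal_minimal)
    fix \<alpha> m assume "\<alpha> \<in> mod_hom R M (ring_module R)" "m \<in> carrier M"
    then show "\<alpha> m \<in> {x \<in> carrier R. r \<otimes> x \<in> trace_ideal R M}"
      using trace_ideal_memI[of \<alpha> "r \<odot>\<^bsub>M\<^esub> m"] r by (simp add: dual_closed dual_smult)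
  next
    fix s t assume "s \<in> {x \<in> carrier R. r \<otimes> x \<in> trace_ideal R M}" "t \<in> {x \<in> carrier R. r \<otimes> x \<in> trace_ideal R M}"
    then show "s \<oplus> t \<in> {x \<in> carrier R. r \<otimes> x \<in> trace_ideal R M}"
      using r by (simp add: trace_ideal_add r_distr)
  qed (use r in \<open>simp add: trace_ideal_zero\<close>)
  from subsetD[OF this x] show ?thesis by simp
qed

lemma trace_ideal_ideal: "ideal (trace_ideal R M) R"
proof (rule idealI)
  show "subgroup (trace_ideal R M) (add_monoid R)"
  proof (rule R.add.subgroupI)
    fix x assume x: "x \<in> trace_ideal R M"
    then have "\<ominus> \<one> \<otimes> x = \<ominus> x" using l_minus[OF one_closed trace_ideal_carr] trace_ideal_carr by simp
    with trace_ideal_smult[OF R.a_inv_closed[OF one_closed] x] show "\<ominus> x \<in> trace_ideal R M" by simp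
  next
    show "trace_ideal R M \<noteq> {}" using trace_ideal_zero by blast
  qed (simp_all add: trace_ideal_closed trace_ideal_add)
  fix a x assume a: "a \<in> trace_ideal R M" and x: "x \<in> carrier R"
  show "x \<otimes> a \<in> trace_ideal R M" by (rule trace_ideal_smult[OF x a])
  then show "a \<otimes> x \<in> trace_ideal R M" using m_comm[OF x trace_ideal_carr[OF a]] by simp
qed (rule ring_axioms)

lemma trace_ideal_submodule: "submodule (trace_ideal R M) R (ring_module R)"
proof (rule module.submoduleI[OF ring_module_module])
  \<comment> \<open>Negation depends only on the carrier, zero and addition, which both records
    share.\<close>
  have "\<ominus>\<^bsub>ring_module R\<^esub> x = \<ominus> x" for x
    by (simp add: a_inv_def m_inv_def ring_module_def)
  then show "\<ominus>\<^bsub>ring_module R\<^esub> x \<in> trace_ideal R M" if "x \<in> trace_ideal R M" for x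
    using additive_subgroup.a_inv_closed[OF ideal.axioms(1)[OF trace_ideal_ideal] that] by simp
qed (simp_all add: trace_ideal_closed trace_ideal_zero trace_ideal_add trace_ideal_smult)

lemma trace_module_module: "module R (trace_module R M)"
  unfolding trace_module_def
  by (rule submodule.submodule_is_module[OF trace_ideal_submodule ring_module_module])

lemma trace_End_eqI:
  assumes h: "h \<in> mod_hom R (trace_module R M) (trace_module R M)"
    and h': "h' \<in> mod_hom R (trace_module R M) (trace_module R M)"
    and eq: "\<And>\<alpha> m. \<lbrakk>\<alpha> \<in> mod_hom R M (ring_module R); m \<in> carrier M\<rbrakk> \<Longrightarrow> h (\<alpha> m) = h' (\<alpha> m)"
  shows "h = h'"
proof (rule mod_hom_eqI[OF h h'])
  have "trace_ideal R M \<subseteq> {t \<in> trace_ideal R M. h t = h' t}"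
  proof (rule trace_ideal_minimal)
    note zero = mod_hom_zero[OF trace_module_module trace_module_module]
    show "\<zero> \<in> {t \<in> trace_ideal R M. h t = h' t}"
      using zero[OF h] zero[OF h'] by (simp add: trace_ideal_zero)
    show "s \<oplus> t \<in> {t \<in> trace_ideal R M. h t = h' t}"
      if "s \<in> {t \<in> trace_ideal R M. h t = h' t}" "t \<in> {t \<in> trace_ideal R M. h t = h' t}" for s t
      using that mod_hom_add[OF h, of s t] mod_hom_add[OF h', of s t] by (simp add: trace_ideal_add)
  qed (simp add: trace_ideal_memI eq)
  then show "h x = h' x" if "x \<in> carrier (trace_module R M)" for x using that by auto
qed

section \<open>The map \<open>\<sigma>\<close>\<close>

text \<open>Serves \<open>theta\<close>, where f is an endomorphism, and \<open>trace_map\<close>,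
  where f is the identity. The conditions on f are stated elementwise because the plain identity
  function is not extensional and so need not belong to \<open>mod_hom R M M\<close>.\<close>

lemma evaluation_lift:
  assumes f: "\<And>m. m \<in> carrier M \<Longrightarrow> f m \<in> carrier M"
    "\<And>m n. \<lbrakk>m \<in> carrier M; n \<in> carrier M\<rbrakk> \<Longrightarrow> f (m \<oplus>\<^bsub>M\<^esub> n) = f m \<oplus>\<^bsub>M\<^esub> f n"
    "\<And>r m. \<lbrakk>r \<in> carrier R; m \<in> carrier M\<rbrakk> \<Longrightarrow> f (r \<odot>\<^bsub>M\<^esub> m) = r \<odot>\<^bsub>M\<^esub> f m"
  defines "g \<equiv> tensor_lift R M (dual_module R M) (ring_module R) (\<lambda>m \<alpha>. \<alpha> (f m))"
  shows "g \<in> mod_hom R (tensor_module R M (dual_module R M)) (ring_module R)"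
    and "\<lbrakk>m \<in> carrier M; \<alpha> \<in> mod_hom R M (ring_module R)\<rbrakk> \<Longrightarrow>
      g (pure_tensor R M (dual_module R M) m \<alpha>) = \<alpha> (f m)"
proof -
  have "\<exists>g\<in>mod_hom R (tensor_module R M (dual_module R M)) (ring_module R).
    \<forall>m\<in>carrier M. \<forall>\<alpha>\<in>carrier (dual_module R M). g (pure_tensor R M (dual_module R M) m \<alpha>) = \<alpha> (f m)"
    by (rule tensor_lift_exists[OF module_axioms dual_module_module ring_module_module])
       (auto simp: f dual_closed dual_add dual_smult)
  then obtain g' where g': "g' \<in> mod_hom R (tensor_module R M (dual_module R M)) (ring_module R)"
    "\<And>m \<alpha>. \<lbrakk>m \<in> carrier M; \<alpha> \<in> carrier (dual_module R M)\<rbrakk> \<Longrightarrow>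
      g' (pure_tensor R M (dual_module R M) m \<alpha>) = \<alpha> (f m)"
    by blast
  have "g = g'"
    unfolding g_def
    by (rule tensor_lift_unique[OF module_axioms dual_module_module ring_module_module g'])
  then show "g \<in> mod_hom R (tensor_module R M (dual_module R M)) (ring_module R)"
    and "\<lbrakk>m \<in> carrier M; \<alpha> \<in> mod_hom R M (ring_module R)\<rbrakk> \<Longrightarrow>
      g (pure_tensor R M (dual_module R M) m \<alpha>) = \<alpha> (f m)"
    using g' by simp_all
qed

lemma theta_hom:
  "f \<in> mod_hom R M M \<Longrightarrow> theta R M f \<in> mod_hom R (tensor_module R M (dual_module R M)) (ring_module R)"
  unfolding theta_def by (rule evaluation_lift) (auto simp: mod_hom_closed mod_hom_add mod_hom_smult)

lemma theta_pure_tensor: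
  "\<lbrakk>f \<in> mod_hom R M M; m \<in> carrier M; \<alpha> \<in> mod_hom R M (ring_module R)\<rbrakk> \<Longrightarrow>
    theta R M f (pure_tensor R M (dual_module R M) m \<alpha>) = \<alpha> (f m)"
  unfolding theta_def by (rule evaluation_lift) (auto simp: mod_hom_closed mod_hom_add mod_hom_smult)

lemma trace_map_hom:
  "trace_map R M \<in> mod_hom R (tensor_module R M (dual_module R M)) (ring_module R)"
  unfolding trace_map_def by (rule evaluation_lift(1)[of "\<lambda>m. m"]) auto

lemma trace_map_pure_tensor:
  "\<lbrakk>m \<in> carrier M; \<alpha> \<in> mod_hom R M (ring_module R)\<rbrakk> \<Longrightarrow>
    trace_map R M (pure_tensor R M (dual_module R M) m \<alpha>) = \<alpha> m"
  unfolding trace_map_def by (rule evaluation_lift(2)[of "\<lambda>m. m"]) auto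

text \<open>Needed before an endomorphism h can be pulled back, since h carries information only on
  the trace ideal.\<close>

lemma trace_map_in_trace_ideal:
  assumes "C \<in> carrier (tensor_module R M (dual_module R M))"
  shows "trace_map R M C \<in> trace_ideal R M"
  using module_axioms dual_module_module assms
proof (induction C rule: tensor_module_induct)
  case (zero D)
  then show ?case
    using mod_hom_smult[OF trace_map_hom R.zero_closed zero] mod_hom_closed[OF trace_map_hom zero]
    by (simp add: trace_ideal_zero)
next
  case (add D r m \<alpha>)
  then show ?case
    by (simp add: mod_hom_add[OF trace_map_hom] mod_hom_smult[OF trace_map_hom]
        trace_map_pure_tensor trace_ideal_add trace_ideal_smult trace_ideal_memI)
qed

lemma trace_pullback_hom:
  assumes h: "h \<in> mod_hom R (trace_module R M) (trace_module R M)"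
  shows "trace_pullback R M h \<in> mod_hom R (tensor_module R M (dual_module R M)) (ring_module R)"
proof (rule mod_homI)
  let ?T = "tensor_module R M (dual_module R M)"
  have "h t \<in> carrier R" if "t \<in> trace_ideal R M" for t
    using mod_hom_closed[OF h] that trace_ideal_closed by auto
  then show "trace_pullback R M h \<in> carrier ?T \<rightarrow>\<^sub>E carrier (ring_module R)"
    by (auto simp: trace_pullback_def compose_def trace_map_in_trace_ideal)
  note closed = tensor_module_closed[OF module_axioms dual_module_module]
  fix C assume C: "C \<in> carrier ?T"
  show "trace_pullback R M h (C \<oplus>\<^bsub>?T\<^esub> D)
      = trace_pullback R M h C \<oplus>\<^bsub>ring_module R\<^esub> trace_pullback R M h D" if "D \<in> carrier ?T" for D
    using closed(1)[OF C that] C that mod_hom_add[OF h] mod_hom_add[OF trace_map_hom]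
    by (auto simp: trace_pullback_def compose_def trace_map_in_trace_ideal)
  show "trace_pullback R M h (r \<odot>\<^bsub>?T\<^esub> C) = r \<odot>\<^bsub>ring_module R\<^esub> trace_pullback R M h C"
    if "r \<in> carrier R" for r
    using closed(2)[OF C that] C that mod_hom_smult[OF h] mod_hom_smult[OF trace_map_hom]
    by (auto simp: trace_pullback_def compose_def trace_map_in_trace_ideal)
qed

lemma trace_pullback_pure_tensor:
  assumes "m \<in> carrier M" "\<alpha> \<in> mod_hom R M (ring_module R)"
  shows "trace_pullback R M h (pure_tensor R M (dual_module R M) m \<alpha>) = h (\<alpha> m)"
  using pure_tensor_closed[of m M \<alpha> "dual_module R M"] assms
  by (simp add: trace_pullback_def compose_def trace_map_pure_tensor)

end

section \<open>Reflexive modules: from endomorphisms of the trace ideal to endomorphisms of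
  M\<close>

locale reflexive_module_locale = module +
  assumes reflexive: "reflexive_module R M"
begin

text \<open>The injective half of reflexivity. Most identities in M below are proved by applying
  functionals and computing in R.\<close>

lemma dual_separates:
  assumes "m \<in> carrier M" "n \<in> carrier M"
    and "\<And>\<alpha>. \<alpha> \<in> mod_hom R M (ring_module R) \<Longrightarrow> \<alpha> m = \<alpha> n"
  shows "m = n"
proof -
  have "inj_on (evaluation_map R M) (carrier M)"
    using reflexive by (auto simp: reflexive_module_def mod_iso_def bij_betw_def)
  moreover have "evaluation_map R M m = evaluation_map R M n"
    using assms by (auto simp: evaluation_map_def fun_eq_iff)
  ultimately show ?thesis using assms by (meson inj_onD)
qed

text \<open>The surjective half of reflexivity.\<close>

lemma bidual_evaluation:
  assumes "\<psi> \<in> mod_hom R (dual_module R M) (ring_module R)"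
  obtains m where "m \<in> carrier M" "\<And>\<alpha>. \<alpha> \<in> mod_hom R M (ring_module R) \<Longrightarrow> \<psi> \<alpha> = \<alpha> m"
proof -
  have "evaluation_map R M ` carrier M = mod_hom R (dual_module R M) (ring_module R)"
    using reflexive by (auto simp: reflexive_module_def mod_iso_def bij_betw_def)
  then obtain m where "m \<in> carrier M" "\<psi> = evaluation_map R M m" using assms by blast
  then show thesis using that by (auto simp: evaluation_map_def)
qed

lemma theta_inj: "inj_on (theta R M) (mod_hom R M M)"
proof (rule inj_onI)
  fix f g assume f: "f \<in> mod_hom R M M" and g: "g \<in> mod_hom R M M" and eq: "theta R M f = theta R M g"
  show "f = g"
  proof (rule mod_hom_eqI[OF f g])
    fix m assume m: "m \<in> carrier M"
    show "f m = g m"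
    proof (rule dual_separates[OF mod_hom_closed[OF f m] mod_hom_closed[OF g m]])
      show "\<alpha> (f m) = \<alpha> (g m)" if "\<alpha> \<in> mod_hom R M (ring_module R)" for \<alpha>
        using theta_pure_tensor[OF f m that] theta_pure_tensor[OF g m that] eq by simp
    qed
  qed
qed

text \<open>The hypothesis says that \<open>trace_pullback R M h\<close> and
  \<open>theta R M f\<close> agree on pure tensors, hence everywhere; injectivity of
  \<open>theta\<close> then makes \<open>inv_into\<close> return f.\<close>

lemma sigma_eqI:
  assumes h: "h \<in> mod_hom R (trace_module R M) (trace_module R M)" and f: "f \<in> mod_hom R M M"
    and eq: "\<And>\<alpha> m. \<lbrakk>\<alpha> \<in> mod_hom R M (ring_module R); m \<in> carrier M\<rbrakk> \<Longrightarrow> \<alpha> (f m) = h (\<alpha> m)"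
  shows "sigma R M h = f"
proof -
  have "trace_pullback R M h = theta R M f"
    by (rule tensor_hom_eqI[OF module_axioms dual_module_module ring_module_module
          trace_pullback_hom[OF h] theta_hom[OF f]])
       (use f eq in \<open>simp add: trace_pullback_pure_tensor theta_pure_tensor\<close>)
  then show ?thesis using inv_into_f_f[OF theta_inj f] by (simp add: sigma_def)
qed

text \<open>For fixed m the map \<open>\<alpha> \<mapsto> h (\<alpha> m)\<close> is linear on the
  dual, hence evaluation at some element of M, which is taken as \<open>f m\<close>. Linearity of f
  follows after applying functionals, because h is linear.\<close>

lemma trace_End_induces:
  assumes h: "h \<in> mod_hom R (trace_module R M) (trace_module R M)"
  obtains f where "f \<in> mod_hom R M M"
    "\<And>\<alpha> m. \<lbrakk>\<alpha> \<in> mod_hom R M (ring_module R); m \<in> carrier M\<rbrakk> \<Longrightarrow> \<alpha> (f m) = h (\<alpha> m)"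
proof -
  let ?D = "mod_hom R M (ring_module R)"
  have hR: "h t \<in> carrier R" if "t \<in> trace_ideal R M" for t
    using mod_hom_closed[OF h] that trace_ideal_closed by auto
  have hadd: "h (s \<oplus> t) = h s \<oplus> h t" if "s \<in> trace_ideal R M" "t \<in> trace_ideal R M" for s t
    using mod_hom_add[OF h] that by simp
  have hsmult: "h (r \<otimes> t) = r \<otimes> h t" if "r \<in> carrier R" "t \<in> trace_ideal R M" for r t
    using mod_hom_smult[OF h] that by simp
  interpret D: module R "dual_module R M" by (rule dual_module_module)
  have "\<exists>n\<in>carrier M. \<forall>\<alpha>\<in>?D. \<alpha> n = h (\<alpha> m)" if m: "m \<in> carrier M" for m
  proof -
    have "(\<lambda>\<alpha>\<in>carrier (dual_module R M). h (\<alpha> m)) \<in> mod_hom R (dual_module R M) (ring_module R)"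
    proof (rule mod_homI)
      fix \<alpha> \<beta> assume ab: "\<alpha> \<in> carrier (dual_module R M)" "\<beta> \<in> carrier (dual_module R M)"
      have "\<alpha> \<oplus>\<^bsub>dual_module R M\<^esub> \<beta> \<in> carrier (dual_module R M)" using ab by (rule D.M.a_closed)
      moreover have "(\<alpha> \<oplus>\<^bsub>dual_module R M\<^esub> \<beta>) m = \<alpha> m \<oplus> \<beta> m" using m by simp
      ultimately show "(\<lambda>\<alpha>\<in>carrier (dual_module R M). h (\<alpha> m)) (\<alpha> \<oplus>\<^bsub>dual_module R M\<^esub> \<beta>)
          = (\<lambda>\<alpha>\<in>carrier (dual_module R M). h (\<alpha> m)) \<alpha> \<oplus>\<^bsub>ring_module R\<^esub>
            (\<lambda>\<alpha>\<in>carrier (dual_module R M). h (\<alpha> m)) \<beta>"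
        using ab m by (simp add: hadd trace_ideal_memI del: dual_module_simps(3))
    next
      fix r \<alpha> assume ra: "r \<in> carrier R" "\<alpha> \<in> carrier (dual_module R M)"
      have "r \<odot>\<^bsub>dual_module R M\<^esub> \<alpha> \<in> carrier (dual_module R M)" using ra by (rule D.smult_closed)
      moreover have "(r \<odot>\<^bsub>dual_module R M\<^esub> \<alpha>) m = r \<otimes> \<alpha> m" using m by simp
      ultimately show "(\<lambda>\<alpha>\<in>carrier (dual_module R M). h (\<alpha> m)) (r \<odot>\<^bsub>dual_module R M\<^esub> \<alpha>)
          = r \<odot>\<^bsub>ring_module R\<^esub> (\<lambda>\<alpha>\<in>carrier (dual_module R M). h (\<alpha> m)) \<alpha>"
        using ra m by (simp add: hsmult trace_ideal_memI del: dual_module_simps(4))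
    qed (use m in \<open>auto simp: hR trace_ideal_memI\<close>)
    then obtain n where n: "n \<in> carrier M"
      "\<And>\<alpha>. \<alpha> \<in> ?D \<Longrightarrow> (\<lambda>\<alpha>\<in>carrier (dual_module R M). h (\<alpha> m)) \<alpha> = \<alpha> n"
      by (rule bidual_evaluation) blast
    then show ?thesis by (intro bexI[of _ n]) auto
  qed
  then obtain f0 where f0: "\<And>m. m \<in> carrier M \<Longrightarrow> f0 m \<in> carrier M"
    "\<And>m \<alpha>. \<lbrakk>m \<in> carrier M; \<alpha> \<in> ?D\<rbrakk> \<Longrightarrow> \<alpha> (f0 m) = h (\<alpha> m)"
    by metis
  have "restrict f0 (carrier M) \<in> mod_hom R M M"
  proof (rule mod_homI)
    fix m n assume mn: "m \<in> carrier M" "n \<in> carrier M"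
    have "f0 (m \<oplus>\<^bsub>M\<^esub> n) = f0 m \<oplus>\<^bsub>M\<^esub> f0 n"
      by (rule dual_separates) (use mn in \<open>auto simp: f0 dual_add hadd trace_ideal_memI\<close>)
    then show "restrict f0 (carrier M) (m \<oplus>\<^bsub>M\<^esub> n) = restrict f0 (carrier M) m \<oplus>\<^bsub>M\<^esub> restrict f0 (carrier M) n"
      using mn by simp
  next
    fix r m assume rm: "r \<in> carrier R" "m \<in> carrier M"
    have "f0 (r \<odot>\<^bsub>M\<^esub> m) = r \<odot>\<^bsub>M\<^esub> f0 m"
      by (rule dual_separates) (use rm in \<open>auto simp: f0 dual_smult hsmult trace_ideal_memI\<close>)
    then show "restrict f0 (carrier M) (r \<odot>\<^bsub>M\<^esub> m) = r \<odot>\<^bsub>M\<^esub> restrict f0 (carrier M) m"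
      using rm by simp
  qed (auto simp: f0)
  then show thesis by (rule that) (use f0 in auto)
qed

text \<open>Together with \<open>sigma_eqI\<close> this replaces the definition of
  \<open>sigma\<close> in everything that follows; tensors no longer appear.\<close>

lemma sigma_End:
  assumes h: "h \<in> mod_hom R (trace_module R M) (trace_module R M)"
  shows "sigma R M h \<in> mod_hom R M M"
    and "\<lbrakk>\<alpha> \<in> mod_hom R M (ring_module R); m \<in> carrier M\<rbrakk> \<Longrightarrow> \<alpha> (sigma R M h m) = h (\<alpha> m)"
proof -
  obtain f where f: "f \<in> mod_hom R M M"
    "\<And>\<alpha> m. \<lbrakk>\<alpha> \<in> mod_hom R M (ring_module R); m \<in> carrier M\<rbrakk> \<Longrightarrow> \<alpha> (f m) = h (\<alpha> m)"
    using trace_End_induces[OF h] by blast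
  with sigma_eqI[OF h f] show "sigma R M h \<in> mod_hom R M M"
    and "\<lbrakk>\<alpha> \<in> mod_hom R M (ring_module R); m \<in> carrier M\<rbrakk> \<Longrightarrow> \<alpha> (sigma R M h m) = h (\<alpha> m)"
    by simp_all
qed

lemma sigma_central:
  assumes h: "h \<in> mod_hom R (trace_module R M) (trace_module R M)"
  shows "sigma R M h \<in> ring_center (End_ring R M)"
proof -
  note s = sigma_End[OF h]
  have "sigma R M h (g m) = g (sigma R M h m)" if g: "g \<in> mod_hom R M M" and m: "m \<in> carrier M" for g m
  proof (rule dual_separates[OF mod_hom_closed[OF s(1) mod_hom_closed[OF g m]]
        mod_hom_closed[OF g mod_hom_closed[OF s(1) m]]])
    fix \<alpha> assume \<alpha>: "\<alpha> \<in> mod_hom R M (ring_module R)"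
    have ag: "compose (carrier M) \<alpha> g \<in> mod_hom R M (ring_module R)"
      by (rule mod_hom_compose[OF \<alpha> g module_axioms])
    have "\<alpha> (sigma R M h (g m)) = h (\<alpha> (g m))" by (rule s(2)[OF \<alpha> mod_hom_closed[OF g m]])
    also have "\<dots> = h (compose (carrier M) \<alpha> g m)" using m by (simp add: compose_def)
    also have "\<dots> = compose (carrier M) \<alpha> g (sigma R M h m)" by (rule s(2)[OF ag m, symmetric])
    also have "\<dots> = \<alpha> (g (sigma R M h m))" using mod_hom_closed[OF s(1) m] by (simp add: compose_def)
    finally show "\<alpha> (sigma R M h (g m)) = \<alpha> (g (sigma R M h m))" .
  qed
  then have "compose (carrier M) (sigma R M h) g = compose (carrier M) g (sigma R M h)"
    if "g \<in> mod_hom R M M" for g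
    unfolding compose_def using that by (intro restrict_ext) blast
  then show ?thesis using s(1) by (simp add: ring_center_def)
qed

text \<open>The values \<open>h (\<alpha> m)\<close> can be read off from
  \<open>sigma R M h\<close>, and by additivity they determine h.\<close>

lemma sigma_inj: "inj_on (sigma R M) (mod_hom R (trace_module R M) (trace_module R M))"
proof (rule inj_onI)
  fix h h' assume h: "h \<in> mod_hom R (trace_module R M) (trace_module R M)"
    and h': "h' \<in> mod_hom R (trace_module R M) (trace_module R M)"
    and eq: "sigma R M h = sigma R M h'"
  show "h = h'"
  proof (rule trace_End_eqI[OF h h'])
    show "h (\<alpha> m) = h' (\<alpha> m)" if "\<alpha> \<in> mod_hom R M (ring_module R)" "m \<in> carrier M" for \<alpha> m
      using sigma_End(2)[OF h that] sigma_End(2)[OF h' that] eq by simp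
  qed
qed

end

section \<open>Faithful reflexive modules: every central endomorphism comes from the trace
  ideal\<close>

locale faithful_reflexive_module = reflexive_module_locale +
  assumes faithful: "faithful_module R M"
begin

lemma faithful_cancel:
  assumes "r \<in> carrier R" "s \<in> carrier R" "\<And>m. m \<in> carrier M \<Longrightarrow> r \<odot>\<^bsub>M\<^esub> m = s \<odot>\<^bsub>M\<^esub> m"
  shows "r = s"
proof -
  have "(r \<ominus> s) \<odot>\<^bsub>M\<^esub> m = \<zero>\<^bsub>M\<^esub>" if "m \<in> carrier M" for m
    using that assms by (simp add: a_minus_def smult_l_distr smult_l_minus M.r_neg)
  then have "r \<ominus> s = \<zero>" using faithful assms by (auto simp: faithful_module_def)
  then show ?thesis using assms by simp
qed

text \<open>
  A central \<open>f\<close> commutes with the endomorphisms \<open>m \<mapsto> \<alpha>(m) n\<close>, so \<open>\<alpha>(m) f(n) = \<alpha>(f(m)) n\<close>.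
\<close>

lemma central_swap:
  assumes f: "f \<in> ring_center (End_ring R M)" and \<alpha>: "\<alpha> \<in> mod_hom R M (ring_module R)"
    and mn: "m \<in> carrier M" "n \<in> carrier M"
  shows "\<alpha> (f m) \<odot>\<^bsub>M\<^esub> n = \<alpha> m \<odot>\<^bsub>M\<^esub> f n"
proof -
  have f': "f \<in> mod_hom R M M" using f by (simp add: ring_center_def)
  let ?g = "\<lambda>x\<in>carrier M. \<alpha> x \<odot>\<^bsub>M\<^esub> n"
  have g: "?g \<in> mod_hom R M M"
    by (rule mod_homI)
       (use mn \<alpha> in \<open>auto simp: dual_closed dual_add dual_smult smult_l_distr smult_assoc1\<close>)
  then have "compose (carrier M) f ?g m = compose (carrier M) ?g f m"
    using f by (simp add: ring_center_def)
  then show ?thesis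
    using mn \<alpha> mod_hom_closed[OF f' mn(1)] by (simp add: compose_def mod_hom_smult[OF f'] dual_closed)
qed

text \<open>The preimage of \<open>f\<close> sends \<open>t\<close> to the unique \<open>s\<close> with \<open>s n = t f(n)\<close> for all \<open>n\<close>.\<close>

lemma central_in_range:
  assumes f: "f \<in> ring_center (End_ring R M)"
  shows "\<exists>h\<in>mod_hom R (trace_module R M) (trace_module R M). sigma R M h = f"
proof -
  have f': "f \<in> mod_hom R M M" using f by (simp add: ring_center_def)
  note fM = mod_hom_closed[OF f']
  let ?\<tau> = "trace_ideal R M"
  \<comment> \<open>A relation, since t has no preferred expression as a sum of values. Demanding
    that s lie in the trace ideal makes the resulting map an endomorphism of it.\<close>
  define rel where "rel t s \<longleftrightarrow> t \<in> carrier R \<and> s \<in> ?\<tau> \<and> (\<forall>n\<in>carrier M. s \<odot>\<^bsub>M\<^esub> n = t \<odot>\<^bsub>M\<^esub> f n)" for t s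
  have \<tau>R: "s \<in> carrier R" if "s \<in> ?\<tau>" for s using that trace_ideal_closed by blast
  have rel_unique: "s = s'" if "rel t s" "rel t s'" for t s s'
    using that unfolding rel_def by (intro faithful_cancel) (auto intro: \<tau>R)
  have rel_add: "rel (t \<oplus> t') (s \<oplus> s')" if "rel t s" "rel t' s'" for t t' s s'
    using that fM unfolding rel_def by (auto simp: trace_ideal_add smult_l_distr \<tau>R)
  have rel_smult: "rel (r \<otimes> t) (r \<otimes> s)" if "r \<in> carrier R" "rel t s" for r t s
    using that fM unfolding rel_def by (auto simp: trace_ideal_smult smult_assoc1 \<tau>R)
  have rel_mem: "rel (\<alpha> m) (\<alpha> (f m))" if "\<alpha> \<in> mod_hom R M (ring_module R)" "m \<in> carrier M" for \<alpha> m
    using that central_swap[OF f] fM unfolding rel_def by (auto simp: trace_ideal_memI dual_closed)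
  \<comment> \<open>Existence is additive in t, and \<open>\<alpha> (f m)\<close> is a partner for
    \<open>\<alpha> m\<close> by \<open>central_swap\<close>. Linearity of the chosen function then
    follows from uniqueness: both sides are partners of the same element.\<close>
  have "?\<tau> \<subseteq> {t. \<exists>s. rel t s}"
  proof (rule trace_ideal_minimal)
    have "rel \<zero> \<zero>" using fM by (auto simp: rel_def trace_ideal_zero)
    then show "\<zero> \<in> {t. \<exists>s. rel t s}" by blast
    show "t \<oplus> t' \<in> {t. \<exists>s. rel t s}" if "t \<in> {t. \<exists>s. rel t s}" "t' \<in> {t. \<exists>s. rel t s}" for t t'
      using that rel_add[of t _ t'] by blast
    show "\<alpha> m \<in> {t. \<exists>s. rel t s}" if "\<alpha> \<in> mod_hom R M (ring_module R)" "m \<in> carrier M" for \<alpha> m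
      using rel_mem[OF that] by blast
  qed
  then have "\<forall>t\<in>?\<tau>. \<exists>s. rel t s" by blast
  then obtain h0 where h0: "\<And>t. t \<in> ?\<tau> \<Longrightarrow> rel t (h0 t)" by (rule bchoice[THEN exE]) blast
  define h where "h = restrict h0 ?\<tau>"
  have h: "rel t (h t)" if "t \<in> ?\<tau>" for t using h0 that by (simp add: h_def)
  have "h \<in> mod_hom R (trace_module R M) (trace_module R M)"
  proof (rule mod_homI)
    show "h \<in> carrier (trace_module R M) \<rightarrow>\<^sub>E carrier (trace_module R M)"
      using h0 by (auto simp: h_def rel_def)
    show "h (x \<oplus>\<^bsub>trace_module R M\<^esub> y) = h x \<oplus>\<^bsub>trace_module R M\<^esub> h y"
      if "x \<in> carrier (trace_module R M)" "y \<in> carrier (trace_module R M)" for x y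
      using that rel_unique[OF h rel_add[OF h h]] by (simp add: trace_ideal_add)
    show "h (r \<odot>\<^bsub>trace_module R M\<^esub> x) = r \<odot>\<^bsub>trace_module R M\<^esub> h x"
      if "r \<in> carrier R" "x \<in> carrier (trace_module R M)" for r x
      using that rel_unique[OF h rel_smult[OF _ h]] by (simp add: trace_ideal_smult)
  qed
  moreover from this have "sigma R M h = f"
  proof (rule sigma_eqI[OF _ f'])
    show "\<alpha> (f m) = h (\<alpha> m)" if "\<alpha> \<in> mod_hom R M (ring_module R)" "m \<in> carrier M" for \<alpha> m
      by (rule rel_unique[OF rel_mem[OF that] h[OF trace_ideal_memI[OF that]]])
  qed
  ultimately show ?thesis by blast
qed

lemma sigma_bij_betw:
  "bij_betw (sigma R M) (carrier (End_ring R (trace_module R M))) (ring_center (End_ring R M))"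
  unfolding bij_betw_def End_ring_simps
  using sigma_inj sigma_central central_in_range by blast

text \<open>If c kills every \<open>\<alpha> m\<close>, then all functionals vanish on c m, so c m
  is zero by separation and c is zero by faithfulness.\<close>

lemma trace_ideal_has_nonzerodivisor:
  assumes "noetherian_ring R"
  shows "trace_ideal R M \<inter> nonzerodivisors R \<noteq> {}"
proof (rule noetherian_ideal_has_nonzerodivisor[OF assms trace_ideal_ideal])
  fix c assume c: "c \<in> carrier R" and ann: "\<And>x. x \<in> trace_ideal R M \<Longrightarrow> x \<otimes> c = \<zero>"
  have "c \<odot>\<^bsub>M\<^esub> m = \<zero>\<^bsub>M\<^esub>" if m: "m \<in> carrier M" for m
  proof (rule dual_separates)
    fix \<alpha> assume "\<alpha> \<in> mod_hom R M (ring_module R)"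
    then show "\<alpha> (c \<odot>\<^bsub>M\<^esub> m) = \<alpha> \<zero>\<^bsub>M\<^esub>"
      using ann[OF trace_ideal_memI[OF _ m]] c m by (simp add: dual_smult dual_zero dual_closed m_comm)
  qed (use c m in auto)
  then show "c = \<zero>" using faithful c by (auto simp: faithful_module_def)
qed

end

section \<open>Fractions\<close>

context cring
begin

lemma nonzerodivisor_closed: "b \<in> nonzerodivisors R \<Longrightarrow> b \<in> carrier R"
  by (simp add: nonzerodivisors_def)

lemma nonzerodivisor_cancel:
  assumes b: "b \<in> nonzerodivisors R" and xy: "x \<in> carrier R" "y \<in> carrier R" "b \<otimes> x = b \<otimes> y"
  shows "x = y"
proof -
  have bR: "b \<in> carrier R" by (rule nonzerodivisor_closed[OF b])
  have "b \<otimes> (x \<ominus> y) = \<zero>" using xy bR by (simp add: minus_eq r_distr r_minus r_neg)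
  then have "x \<ominus> y = \<zero>" using b xy by (simp add: nonzerodivisors_def)
  then show ?thesis using xy by simp
qed

lemma nonzerodivisor_one: "\<one> \<in> nonzerodivisors R"
  by (simp add: nonzerodivisors_def)

lemma nonzerodivisor_mult:
  assumes "b \<in> nonzerodivisors R" "d \<in> nonzerodivisors R"
  shows "b \<otimes> d \<in> nonzerodivisors R"
proof -
  note bR = nonzerodivisor_closed[OF assms(1)] and dR = nonzerodivisor_closed[OF assms(2)]
  have "y = \<zero>" if y: "y \<in> carrier R" "(b \<otimes> d) \<otimes> y = \<zero>" for y
  proof -
    have "b \<otimes> (d \<otimes> y) = b \<otimes> \<zero>" using y bR dR by (simp add: m_assoc)
    then have "d \<otimes> y = d \<otimes> \<zero>" using nonzerodivisor_cancel[OF assms(1)] y dR by simp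
    then show ?thesis by (rule nonzerodivisor_cancel[OF assms(2) y(1) zero_closed])
  qed
  then show ?thesis using bR dR by (simp add: nonzerodivisors_def)
qed

lemma frac_rel_iff:
  "((a, b), (c, d)) \<in> frac_rel R \<longleftrightarrow> a \<in> carrier R \<and> b \<in> nonzerodivisors R \<and>
    c \<in> carrier R \<and> d \<in> nonzerodivisors R \<and> a \<otimes> d = c \<otimes> b"
  by (simp add: frac_rel_def)

lemma frac_rel_equiv: "equiv (carrier R \<times> nonzerodivisors R) (frac_rel R)"
proof (rule equivI)
  show "frac_rel R \<subseteq> (carrier R \<times> nonzerodivisors R) \<times> (carrier R \<times> nonzerodivisors R)"
    by (auto simp: frac_rel_def)
  show "refl_on (carrier R \<times> nonzerodivisors R) (frac_rel R)"
    by (auto simp: refl_on_def frac_rel_def)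
  show "sym (frac_rel R)"
    by (auto simp: sym_def frac_rel_def)
  show "trans (frac_rel R)"
  proof (rule transI)
    fix p q r assume pq: "(p, q) \<in> frac_rel R" and qr: "(q, r) \<in> frac_rel R"
    obtain a b c d e f where eqs: "p = (a, b)" "q = (c, d)" "r = (e, f)" by (metis surj_pair)
    have mem: "a \<in> carrier R" "b \<in> nonzerodivisors R" "c \<in> carrier R" "d \<in> nonzerodivisors R"
      "e \<in> carrier R" "f \<in> nonzerodivisors R" and eq1: "a \<otimes> d = c \<otimes> b" and eq2: "c \<otimes> f = e \<otimes> d"
      using pq qr by (simp_all add: eqs frac_rel_iff)
    have R: "b \<in> carrier R" "d \<in> carrier R" "f \<in> carrier R"
      using mem by (auto intro: nonzerodivisor_closed)
    \<comment> \<open>Transitivity: multiply by the middle denominator d, use both cross products,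
      and cancel d, a nonzerodivisor.\<close>
    have "d \<otimes> (a \<otimes> f) = (a \<otimes> d) \<otimes> f" using mem(1) R by (simp add: m_assoc m_comm m_lcomm)
    also have "\<dots> = (c \<otimes> f) \<otimes> b" unfolding eq1 using mem(3) R by (simp add: m_assoc m_comm m_lcomm)
    also have "\<dots> = d \<otimes> (e \<otimes> b)" unfolding eq2 using mem(5) R by (simp add: m_assoc m_comm m_lcomm)
    finally have "a \<otimes> f = e \<otimes> b" using nonzerodivisor_cancel[OF mem(4)] mem(1,5) R by simp
    then show "(p, r) \<in> frac_rel R" using mem by (simp add: eqs frac_rel_iff)
  qed
qed

lemma fraction_eq_iff:
  assumes "a \<in> carrier R" "b \<in> nonzerodivisors R" "c \<in> carrier R" "d \<in> nonzerodivisors R"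
  shows "fraction R a b = fraction R c d \<longleftrightarrow> a \<otimes> d = c \<otimes> b"
proof -
  have "fraction R a b = fraction R c d \<longleftrightarrow> ((a, b), (c, d)) \<in> frac_rel R"
    unfolding fraction_def by (rule eq_equiv_class_iff[OF frac_rel_equiv]) (use assms in auto)
  then show ?thesis using assms by (simp add: frac_rel_iff)
qed

lemma mem_fractionD:
  assumes "(c, d) \<in> fraction R a b"
  shows "a \<in> carrier R" "b \<in> nonzerodivisors R" "c \<in> carrier R" "d \<in> nonzerodivisors R"
    "a \<otimes> d = c \<otimes> b"
  using assms by (auto simp: fraction_def frac_rel_iff)

lemma fraction_self: "\<lbrakk>a \<in> carrier R; b \<in> nonzerodivisors R\<rbrakk> \<Longrightarrow> (a, b) \<in> fraction R a b"
  by (simp add: fraction_def frac_rel_iff)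

lemma total_quotient_ring_carrier:
  "q \<in> carrier (total_quotient_ring R) \<longleftrightarrow>
    (\<exists>a b. a \<in> carrier R \<and> b \<in> nonzerodivisors R \<and> q = fraction R a b)"
  by (auto simp: total_quotient_ring_def quotient_def fraction_def)

text \<open>Multiplication in the quotient ring is a union over all pairs of representatives. Each
  pair yields the same class, so the nonempty union collapses to it.\<close>

lemma fraction_mult:
  assumes "a \<in> carrier R" "b \<in> nonzerodivisors R" "c \<in> carrier R" "d \<in> nonzerodivisors R"
  shows "fraction R a b \<otimes>\<^bsub>total_quotient_ring R\<^esub> fraction R c d = fraction R (a \<otimes> c) (b \<otimes> d)"
proof -
  have *: "fraction R (a' \<otimes> c') (b' \<otimes> d') = fraction R (a \<otimes> c) (b \<otimes> d)"
    if p: "(a', b') \<in> fraction R a b" and q: "(c', d') \<in> fraction R c d" for a' b' c' d'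
  proof -
    note p' = mem_fractionD[OF p] and q' = mem_fractionD[OF q]
    note R = p'(1,3) q'(1,3) p'(2,4)[THEN nonzerodivisor_closed] q'(2,4)[THEN nonzerodivisor_closed]
    have "(a' \<otimes> c') \<otimes> (b \<otimes> d) = (a' \<otimes> b) \<otimes> (c' \<otimes> d)"
      using R by (simp add: m_assoc m_lcomm)
    also have "\<dots> = (a \<otimes> b') \<otimes> (c \<otimes> d')" using p'(5) q'(5) by simp
    also have "\<dots> = (a \<otimes> c) \<otimes> (b' \<otimes> d')" using R by (simp add: m_assoc m_lcomm)
    finally show ?thesis using p' q' by (subst fraction_eq_iff) (auto intro: nonzerodivisor_mult)
  qed
  have "(\<Union>(c', d')\<in>fraction R c d. fraction R (a' \<otimes> c') (b' \<otimes> d')) = fraction R (a \<otimes> c) (b \<otimes> d)"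
    if p: "(a', b') \<in> fraction R a b" for a' b'
  proof (rule SUP_eq_const)
    show "fraction R c d \<noteq> {}" using fraction_self assms by blast
    show "(case x of (c', d') \<Rightarrow> fraction R (a' \<otimes> c') (b' \<otimes> d')) = fraction R (a \<otimes> c) (b \<otimes> d)"
      if "x \<in> fraction R c d" for x using *[OF p, of "fst x" "snd x"] that by (simp add: case_prod_beta)
  qed
  moreover have "fraction R a b \<noteq> {}" using fraction_self assms by blast
  ultimately have "(\<Union>(a', b')\<in>fraction R a b. \<Union>(c', d')\<in>fraction R c d. fraction R (a' \<otimes> c') (b' \<otimes> d'))
      = fraction R (a \<otimes> c) (b \<otimes> d)"
    by (intro SUP_eq_const) (simp_all add: case_prod_beta)
  then show ?thesis by (simp add: total_quotient_ring_def)
qed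

text \<open>Clears denominators in \<open>(a/b)(t/1) = s/1\<close>, turning membership into
  equations in R.\<close>

lemma fraction_mem_stabilizer_iff:
  assumes I: "I \<subseteq> carrier R" and a: "a \<in> carrier R" and b: "b \<in> nonzerodivisors R"
  shows "fraction R a b \<in> frac_stabilizer R I \<longleftrightarrow> (\<forall>t\<in>I. \<exists>s\<in>I. a \<otimes> t = s \<otimes> b)"
proof -
  have "fraction R a b \<otimes>\<^bsub>total_quotient_ring R\<^esub> quot_embed R t = quot_embed R s \<longleftrightarrow> a \<otimes> t = s \<otimes> b"
    if "t \<in> I" "s \<in> I" for t s
  proof -
    have "t \<in> carrier R" "s \<in> carrier R" using that I by auto
    then show ?thesis
      using a b nonzerodivisor_closed[OF b] fraction_eq_iff[of "a \<otimes> t" b s \<one>]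
      by (simp add: quot_embed_def fraction_mult nonzerodivisor_one)
  qed
  moreover have "fraction R a b \<in> carrier (total_quotient_ring R)"
    using a b by (auto simp: total_quotient_ring_carrier)
  ultimately show ?thesis
    unfolding frac_stabilizer_def by (simp add: image_subset_iff image_iff)
qed

end

section \<open>Endomorphisms of the trace ideal as fractions\<close>

context module
begin

lemma trace_End_closed:
  assumes "h \<in> mod_hom R (trace_module R M) (trace_module R M)" "t \<in> trace_ideal R M"
  shows "h t \<in> trace_ideal R M" "h t \<in> carrier R"
  using mod_hom_closed[OF assms(1)] assms(2) trace_ideal_carr by simp_all

text \<open>Both sides equal \<open>h (s \<otimes> t)\<close>, with one factor or the other treated
  as the scalar.\<close>

lemma trace_End_swap:
  assumes h: "h \<in> mod_hom R (trace_module R M) (trace_module R M)"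
    and s: "s \<in> trace_ideal R M" and t: "t \<in> trace_ideal R M"
  shows "h s \<otimes> t = h t \<otimes> s"
proof -
  note R = trace_ideal_carr[OF s] trace_ideal_carr[OF t] trace_End_closed(2)[OF h s] trace_End_closed(2)[OF h t]
  have "h s \<otimes> t = t \<otimes> h s" using R by (simp add: m_comm)
  also have "\<dots> = h (t \<otimes> s)" using mod_hom_smult[OF h R(2), of s] s by simp
  also have "\<dots> = h (s \<otimes> t)" using R by (simp add: m_comm)
  also have "\<dots> = s \<otimes> h t" using mod_hom_smult[OF h R(1), of t] t by simp
  also have "\<dots> = h t \<otimes> s" using R by (simp add: m_comm)
  finally show ?thesis .
qed

end

section \<open>The Noetherian case: identification with the stabilizer in the total ring of
  quotients\<close>

locale noetherian_faithful_reflexive_module = faithful_reflexive_module +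
  assumes noetherian: "noetherian_ring R"
begin

text \<open>Removes the arbitrary choice made by \<open>SOME\<close>: for two nonzerodivisors in the
  trace ideal, \<open>trace_End_swap\<close> is exactly the cross-multiplied equality of the two
  fractions.\<close>

lemma End_trace_frac_eq:
  assumes h: "h \<in> mod_hom R (trace_module R M) (trace_module R M)"
    and x: "x \<in> trace_ideal R M" "x \<in> nonzerodivisors R"
  shows "End_trace_frac R M h = fraction R (h x) x"
proof -
  define y where "y = (SOME y. y \<in> trace_ideal R M \<inter> nonzerodivisors R)"
  have "y \<in> trace_ideal R M \<inter> nonzerodivisors R"
    unfolding y_def by (rule someI_ex) (use trace_ideal_has_nonzerodivisor[OF noetherian] in blast)
  then have y: "y \<in> trace_ideal R M" "y \<in> nonzerodivisors R" by auto
  have "fraction R (h y) y = fraction R (h x) x"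
    using trace_End_swap[OF h y(1) x(1)] trace_End_closed(2)[OF h] x y by (simp add: fraction_eq_iff)
  then show ?thesis by (simp add: End_trace_frac_def Let_def y_def)
qed

text \<open>Clearing denominators in \<open>h(x)/x = a/b\<close> shows that \<open>h\<close> is multiplication by \<open>a/b\<close>.\<close>

lemma End_trace_frac_mult:
  assumes h: "h \<in> mod_hom R (trace_module R M) (trace_module R M)"
    and a: "a \<in> carrier R" and b: "b \<in> nonzerodivisors R"
    and eq: "End_trace_frac R M h = fraction R a b" and t: "t \<in> trace_ideal R M"
  shows "b \<otimes> h t = a \<otimes> t"
proof -
  obtain x where x: "x \<in> trace_ideal R M" "x \<in> nonzerodivisors R"
    using trace_ideal_has_nonzerodivisor[OF noetherian] by blast
  note hx = trace_End_closed(2)[OF h x(1)] and ht = trace_End_closed(2)[OF h t]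
  note bR = nonzerodivisor_closed[OF b] and xR = trace_ideal_carr[OF x(1)] and tR = trace_ideal_carr[OF t]
  have hxb: "h x \<otimes> b = a \<otimes> x"
    using eq End_trace_frac_eq[OF h x] fraction_eq_iff[OF hx x(2) a b] by simp
  \<comment> \<open>It suffices to compare after multiplying by the nonzerodivisor x, where
    \<open>h t \<otimes> x\<close> can be traded for \<open>h x \<otimes> t\<close>.\<close>
  have "x \<otimes> (b \<otimes> h t) = b \<otimes> (h t \<otimes> x)" using bR xR ht by (simp add: m_comm m_lcomm)
  also have "\<dots> = b \<otimes> (h x \<otimes> t)" using trace_End_swap[OF h t x(1)] by simp
  also have "\<dots> = (h x \<otimes> b) \<otimes> t" using bR hx tR by (simp add: m_assoc m_lcomm)
  also have "\<dots> = x \<otimes> (a \<otimes> t)" unfolding hxb using a xR tR by (simp add: m_assoc m_lcomm)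
  finally show ?thesis using nonzerodivisor_cancel[OF x(2)] a bR tR ht by simp
qed

text \<open>Both maps are multiplication by the common fraction \<open>h x / x\<close>, so they
  agree after multiplication by x, which cancels.\<close>

lemma End_trace_frac_inj: "inj_on (End_trace_frac R M) (mod_hom R (trace_module R M) (trace_module R M))"
proof (rule inj_onI)
  fix h h' assume h: "h \<in> mod_hom R (trace_module R M) (trace_module R M)"
    and h': "h' \<in> mod_hom R (trace_module R M) (trace_module R M)"
    and eq: "End_trace_frac R M h = End_trace_frac R M h'"
  obtain x where x: "x \<in> trace_ideal R M" "x \<in> nonzerodivisors R"
    using trace_ideal_has_nonzerodivisor[OF noetherian] by blast
  note hx = trace_End_closed(2)[OF h x(1)]
  note frac = End_trace_frac_eq[OF h x]
  show "h = h'"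
  proof (rule mod_hom_eqI[OF h h'])
    fix t assume "t \<in> carrier (trace_module R M)"
    then have t: "t \<in> trace_ideal R M" by simp
    have "x \<otimes> h t = x \<otimes> h' t"
      using End_trace_frac_mult[OF h hx x(2) frac t] End_trace_frac_mult[OF h' hx x(2) frac[unfolded eq] t]
      by simp
    then show "h t = h' t"
      using nonzerodivisor_cancel[OF x(2)] trace_End_closed(2)[OF h t] trace_End_closed(2)[OF h' t] by simp
  qed
qed

lemma End_trace_frac_mem_stabilizer:
  assumes h: "h \<in> mod_hom R (trace_module R M) (trace_module R M)"
  shows "End_trace_frac R M h \<in> frac_stabilizer R (trace_ideal R M)"
proof -
  obtain x where x: "x \<in> trace_ideal R M" "x \<in> nonzerodivisors R"
    using trace_ideal_has_nonzerodivisor[OF noetherian] by blast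
  have "\<forall>t\<in>trace_ideal R M. \<exists>s\<in>trace_ideal R M. h x \<otimes> t = s \<otimes> x"
    using trace_End_swap[OF h x(1)] trace_End_closed(1)[OF h] by blast
  then show ?thesis
    unfolding End_trace_frac_eq[OF h x]
    using fraction_mem_stabilizer_iff[OF trace_ideal_closed trace_End_closed(2)[OF h x(1)] x(2)] by blast
qed

text \<open>For \<open>q = a/b\<close> the endomorphism sends t to the s in the trace ideal with
  \<open>a t = s b\<close>. As b cancels, s is unique, and uniqueness gives linearity.\<close>

lemma End_trace_frac_surj:
  assumes "q \<in> frac_stabilizer R (trace_ideal R M)"
  shows "\<exists>h\<in>mod_hom R (trace_module R M) (trace_module R M). End_trace_frac R M h = q"
proof -
  have "q \<in> carrier (total_quotient_ring R)" using assms by (simp add: frac_stabilizer_def)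
  then obtain a b where a: "a \<in> carrier R" and b: "b \<in> nonzerodivisors R" and q: "q = fraction R a b"
    by (auto simp: total_quotient_ring_carrier)
  note bR = nonzerodivisor_closed[OF b]
  have "\<forall>t\<in>trace_ideal R M. \<exists>s. s \<in> trace_ideal R M \<and> a \<otimes> t = s \<otimes> b"
    using assms fraction_mem_stabilizer_iff[OF trace_ideal_closed a b] unfolding q by blast
  then obtain h0 where "\<forall>t\<in>trace_ideal R M. h0 t \<in> trace_ideal R M \<and> a \<otimes> t = h0 t \<otimes> b"
    by (rule bchoice[THEN exE])
  then have h0: "h0 t \<in> trace_ideal R M" "h0 t \<in> carrier R" "b \<otimes> h0 t = a \<otimes> t"
    if "t \<in> trace_ideal R M" for t
    using that bR m_comm[OF bR trace_ideal_carr] by (auto intro: trace_ideal_carr)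
  have cancel: "h0 t = s" if "t \<in> trace_ideal R M" "s \<in> carrier R" "b \<otimes> s = a \<otimes> t" for s t
    using nonzerodivisor_cancel[OF b h0(2)[OF that(1)] that(2)] h0(3)[OF that(1)] that(3) by simp
  define h where "h = restrict h0 (trace_ideal R M)"
  have h: "h \<in> mod_hom R (trace_module R M) (trace_module R M)"
  proof (rule mod_homI)
    show "h \<in> carrier (trace_module R M) \<rightarrow>\<^sub>E carrier (trace_module R M)"
      using h0(1) by (simp add: h_def)
    fix s assume "s \<in> carrier (trace_module R M)"
    then have s: "s \<in> trace_ideal R M" by simp
    note sR = trace_ideal_carr[OF s]
    show "h (s \<oplus>\<^bsub>trace_module R M\<^esub> t) = h s \<oplus>\<^bsub>trace_module R M\<^esub> h t"
      if "t \<in> carrier (trace_module R M)" for t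
    proof -
      have t: "t \<in> trace_ideal R M" using that by simp
      have "h0 (s \<oplus> t) = h0 s \<oplus> h0 t"
        by (rule cancel) (use s t a bR sR trace_ideal_carr[OF t] in \<open>simp_all add: h0 r_distr trace_ideal_add\<close>)
      then show ?thesis using s t by (simp add: h_def trace_ideal_add)
    qed
    show "h (r \<odot>\<^bsub>trace_module R M\<^esub> s) = r \<odot>\<^bsub>trace_module R M\<^esub> h s" if r: "r \<in> carrier R" for r
    proof -
      have "b \<otimes> (r \<otimes> h0 s) = r \<otimes> (b \<otimes> h0 s)" using bR r h0(2)[OF s] by (simp add: m_lcomm)
      also have "\<dots> = a \<otimes> (r \<otimes> s)" using h0(3)[OF s] a r sR by (simp add: m_lcomm)
      finally have "h0 (r \<otimes> s) = r \<otimes> h0 s"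
        using r s by (intro cancel) (simp_all add: h0 trace_ideal_smult)
      then show ?thesis using s r by (simp add: h_def trace_ideal_smult)
    qed
  qed
  obtain x where x: "x \<in> trace_ideal R M" "x \<in> nonzerodivisors R"
    using trace_ideal_has_nonzerodivisor[OF noetherian] by blast
  have "h x \<otimes> b = a \<otimes> x"
    using h0(2,3)[OF x(1)] x(1) bR by (simp add: h_def m_comm)
  then have "End_trace_frac R M h = q"
    unfolding End_trace_frac_eq[OF h x] q
    using fraction_eq_iff[OF trace_End_closed(2)[OF h x(1)] x(2) a b] by simp
  with h show ?thesis by blast
qed

lemma End_trace_frac_bij_betw:
  "bij_betw (End_trace_frac R M) (carrier (End_ring R (trace_module R M)))
     (frac_stabilizer R (trace_ideal R M))"
  unfolding bij_betw_def End_ring_simps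
  using End_trace_frac_inj End_trace_frac_mem_stabilizer End_trace_frac_surj by blast

text \<open>Functionals transport cancellation of b from R to M; this is why the quotient
  \<open>(am)/b\<close> in M is unique.\<close>

lemma nonzerodivisor_smult_cancel:
  assumes b: "b \<in> nonzerodivisors R" and mn: "m \<in> carrier M" "n \<in> carrier M" "b \<odot>\<^bsub>M\<^esub> m = b \<odot>\<^bsub>M\<^esub> n"
  shows "m = n"
proof (rule dual_separates[OF mn(1,2)])
  fix \<alpha> assume \<alpha>: "\<alpha> \<in> mod_hom R M (ring_module R)"
  note bR = nonzerodivisor_closed[OF b]
  have "b \<otimes> \<alpha> m = b \<otimes> \<alpha> n"
    using dual_smult[OF \<alpha> bR mn(1)] dual_smult[OF \<alpha> bR mn(2)] mn(3) by simp
  then show "\<alpha> m = \<alpha> n"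
    by (rule nonzerodivisor_cancel[OF b dual_closed[OF \<alpha> mn(1)] dual_closed[OF \<alpha> mn(2)]])
qed

text \<open>Under a functional \<open>\<alpha>\<close> the claim becomes
  \<open>b h(\<alpha> m) = a \<alpha>(m)\<close>, the multiplication formula for h at the element
  \<open>\<alpha> m\<close> of the trace ideal.\<close>

lemma sigma_smult:
  assumes h: "h \<in> mod_hom R (trace_module R M) (trace_module R M)"
    and a: "a \<in> carrier R" and b: "b \<in> nonzerodivisors R"
    and eq: "End_trace_frac R M h = fraction R a b" and m: "m \<in> carrier M"
  shows "b \<odot>\<^bsub>M\<^esub> sigma R M h m = a \<odot>\<^bsub>M\<^esub> m"
proof -
  note bR = nonzerodivisor_closed[OF b]
  note sm = mod_hom_closed[OF sigma_End(1)[OF h] m]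
  show ?thesis
  proof (rule dual_separates[OF smult_closed[OF bR sm] smult_closed[OF a m]])
    fix \<alpha> assume \<alpha>: "\<alpha> \<in> mod_hom R M (ring_module R)"
    have "\<alpha> (b \<odot>\<^bsub>M\<^esub> sigma R M h m) = b \<otimes> h (\<alpha> m)"
      using dual_smult[OF \<alpha> bR sm] sigma_End(2)[OF h \<alpha> m] by simp
    also have "\<dots> = a \<otimes> \<alpha> m" by (rule End_trace_frac_mult[OF h a b eq trace_ideal_memI[OF \<alpha> m]])
    also have "\<dots> = \<alpha> (a \<odot>\<^bsub>M\<^esub> m)" by (rule dual_smult[OF \<alpha> a m, symmetric])
    finally show "\<alpha> (b \<odot>\<^bsub>M\<^esub> sigma R M h m) = \<alpha> (a \<odot>\<^bsub>M\<^esub> m)" .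
  qed
qed

lemma sigma_is_fraction_mult:
  assumes h: "h \<in> mod_hom R (trace_module R M) (trace_module R M)"
    and a: "a \<in> carrier R" and b: "b \<in> nonzerodivisors R"
    and eq: "End_trace_frac R M h = fraction R a b"
  shows "(\<lambda>m. a \<odot>\<^bsub>M\<^esub> m) ` carrier M \<subseteq> (\<lambda>n. b \<odot>\<^bsub>M\<^esub> n) ` carrier M"
    and "\<forall>m\<in>carrier M. (\<exists>!n. n \<in> carrier M \<and> b \<odot>\<^bsub>M\<^esub> n = a \<odot>\<^bsub>M\<^esub> m)
      \<and> sigma R M h m = (THE n. n \<in> carrier M \<and> b \<odot>\<^bsub>M\<^esub> n = a \<odot>\<^bsub>M\<^esub> m)"
proof -
  have s: "sigma R M h m \<in> carrier M \<and> b \<odot>\<^bsub>M\<^esub> sigma R M h m = a \<odot>\<^bsub>M\<^esub> m" if "m \<in> carrier M" for m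
    using mod_hom_closed[OF sigma_End(1)[OF h] that] sigma_smult[OF h a b eq that] by blast
  then show "(\<lambda>m. a \<odot>\<^bsub>M\<^esub> m) ` carrier M \<subseteq> (\<lambda>n. b \<odot>\<^bsub>M\<^esub> n) ` carrier M"
    by (metis imageI image_subsetI)
  have unique: "n = sigma R M h m"
    if m: "m \<in> carrier M" and n: "n \<in> carrier M \<and> b \<odot>\<^bsub>M\<^esub> n = a \<odot>\<^bsub>M\<^esub> m" for m n
    by (rule nonzerodivisor_smult_cancel[OF b]) (use s[OF m] n in simp_all)
  show "\<forall>m\<in>carrier M. (\<exists>!n. n \<in> carrier M \<and> b \<odot>\<^bsub>M\<^esub> n = a \<odot>\<^bsub>M\<^esub> m)
      \<and> sigma R M h m = (THE n. n \<in> carrier M \<and> b \<odot>\<^bsub>M\<^esub> n = a \<odot>\<^bsub>M\<^esub> m)"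
  proof (intro ballI conjI)
    fix m assume m: "m \<in> carrier M"
    show "\<exists>!n. n \<in> carrier M \<and> b \<odot>\<^bsub>M\<^esub> n = a \<odot>\<^bsub>M\<^esub> m"
      using s[OF m] unique[OF m] by (rule ex1I)
    show "sigma R M h m = (THE n. n \<in> carrier M \<and> b \<odot>\<^bsub>M\<^esub> n = a \<odot>\<^bsub>M\<^esub> m)"
      using s[OF m] unique[OF m] by (rule the_equality[symmetric])
  qed
qed

end

theorem corollary3p17:
  fixes R :: "('a, 'r) ring_scheme" and M :: "('a, 'b, 'm) module_scheme"
  assumes "cring R" and "noetherian_ring R"
    and "module R M"
    and "fin_gen_module R M" and "faithful_module R M" and "reflexive_module R M"
  shows "trace_ideal R M \<inter> nonzerodivisors R \<noteq> {}
    \<and> (\<forall>h\<in>carrier (End_ring R (trace_module R M)).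
         \<forall>x\<in>trace_ideal R M \<inter> nonzerodivisors R. End_trace_frac R M h = fraction R (h x) x)
    \<and> bij_betw (End_trace_frac R M) (carrier (End_ring R (trace_module R M)))
         (frac_stabilizer R (trace_ideal R M))
    \<and> bij_betw (sigma R M) (carrier (End_ring R (trace_module R M)))
         (ring_center (End_ring R M))
    \<and> (\<forall>h\<in>carrier (End_ring R (trace_module R M)).
         \<forall>a\<in>carrier R. \<forall>b\<in>nonzerodivisors R. End_trace_frac R M h = fraction R a b \<longrightarrow>
           (\<lambda>m. a \<odot>\<^bsub>M\<^esub> m) ` carrier M \<subseteq> (\<lambda>n. b \<odot>\<^bsub>M\<^esub> n) ` carrier M
           \<and> (\<forall>m\<in>carrier M. (\<exists>!n. n \<in> carrier M \<and> b \<odot>\<^bsub>M\<^esub> n = a \<odot>\<^bsub>M\<^esub> m)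
                \<and> sigma R M h m = (THE n. n \<in> carrier M \<and> b \<odot>\<^bsub>M\<^esub> n = a \<odot>\<^bsub>M\<^esub> m)))"
proof -
  interpret noetherian_faithful_reflexive_module R M
    by (intro noetherian_faithful_reflexive_module.intro faithful_reflexive_module.intro
        reflexive_module_locale.intro reflexive_module_locale_axioms.intro
        faithful_reflexive_module_axioms.intro noetherian_faithful_reflexive_module_axioms.intro assms)
  show ?thesis
  proof (intro conjI ballI impI)
    show "trace_ideal R M \<inter> nonzerodivisors R \<noteq> {}"
      by (rule trace_ideal_has_nonzerodivisor[OF noetherian])
    show "End_trace_frac R M h = fraction R (h x) x"
      if "h \<in> carrier (End_ring R (trace_module R M))" "x \<in> trace_ideal R M \<inter> nonzerodivisors R" for h x
      using that by (intro End_trace_frac_eq) simp_all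
    show "bij_betw (End_trace_frac R M) (carrier (End_ring R (trace_module R M)))
        (frac_stabilizer R (trace_ideal R M))"
      by (rule End_trace_frac_bij_betw)
    show "bij_betw (sigma R M) (carrier (End_ring R (trace_module R M))) (ring_center (End_ring R M))"
      by (rule sigma_bij_betw)
    fix h a b
    assume "h \<in> carrier (End_ring R (trace_module R M))" and a: "a \<in> carrier R"
      and b: "b \<in> nonzerodivisors R" and eq: "End_trace_frac R M h = fraction R a b"
    then have h: "h \<in> mod_hom R (trace_module R M) (trace_module R M)" by simp
    note mult = sigma_is_fraction_mult[OF h a b eq]
    show "(\<lambda>m. a \<odot>\<^bsub>M\<^esub> m) ` carrier M \<subseteq> (\<lambda>n. b \<odot>\<^bsub>M\<^esub> n) ` carrier M"
      by (rule mult(1))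
    fix m assume m: "m \<in> carrier M"
    show "\<exists>!n. n \<in> carrier M \<and> b \<odot>\<^bsub>M\<^esub> n = a \<odot>\<^bsub>M\<^esub> m"
      using bspec[OF mult(2) m] by (rule conjunct1)
    show "sigma R M h m = (THE n. n \<in> carrier M \<and> b \<odot>\<^bsub>M\<^esub> n = a \<odot>\<^bsub>M\<^esub> m)"
      using bspec[OF mult(2) m] by (rule conjunct2)
  qed
qed

end
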